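(* Let $G$ be a compact connected semisimple Lie group and let $\lambda$ be a dominant weight. Then the sequence of probability measures $$m_{\lambda,N}=\frac{1}{(\dim V_\lambda)^{N}}\sum_{\nu\in Q(N\lambda)\cap I^*} m_N(\lambda;\nu)\,\delta_{N^{-1}\nu},\qquad N=1,2,\dots,$$ on $Q(\lambda)$ satisfies the large deviation principle with speed $N$ and rate function $$I_\lambda(x)=\sup_{\tau\in\mathfrak t}\left\{\langle\tau,x\rangle-\log\left(\frac{\sum_{\nu\in M_\lambda}m_1(\lambda;\nu)e^{\langle\nu,\tau\rangle}}{\dim V_\lambda}\right)\right\},\qquad x\in\mathfrak t^* .$$
   Context: Let $T\subset G$ be a maximal torus with Lie algebra $\mathfrak t$, $I=\exp^{-1}(1)\subset\mathfrak t$ the integral lattice, and $I^*\subset\mathfrak t^*$ the dual lattice (lattice of weights). $W$ is the Weyl group and $C\subset\mathfrak t^*$ a fixed open Weyl chamber; dominant weights are the elements of $I^*\cap\overline C$. For a dominant weight $\lambda$, $V_\lambda$ is the irreducible representation of $G$ with highest weight $\lambda$; $m_N(\lambda;\nu)$ is the multiplicity of the weight $\nu$ in $V_\lambda^{\otimes N}$; $M_\lambda=\{\mu\in I^*: m_1(\lambda;\mu)\neq0\}$; $Q(\lambda)\subset\mathfrak t^*$ is the convex hull of the Weyl orbit $W\lambda$, and $Q(N\lambda)=NQ(\lambda)$. Large deviation principle: a sequence $m_N$ of probability measures on a closed set $E\subset\mathbb R^n$ satisfies the large deviation principle with speed $N$ and (lower semicontinuous) rate function $J:E\to[0,\infty]$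 if (1) $J^{-1}[0,c]$ is compact for every $c\in\mathbb R$; (2) for each closed $F\subset E$, $\limsup_{N\to\infty}\frac1N\log m_N(F)\le-\inf_{x\in F}J(x)$; (3) for each open $U\subset E$, $\liminf_{N\to\infty}\frac1N\log m_N(U)\ge-\inf_{x\in U}J(x)$. Here $E=Q(\lambda)$ and $J=I_\lambda|_{Q(\lambda)}$. *)

theory Defs
  imports "HOL-Probability.Probability" "HOL-Algebra.Group" "HOL-Library.Function_Algebras"
begin

section \<open>Lie groups\<close>

text \<open>\<open>C\<^sup>k\<close>-maps and smooth maps on an open subset \<open>S\<close> of a normed space; the recursion runs through
  all directional derivatives.\<close>

primrec Ck_on :: "nat \<Rightarrow> 'a::real_normed_vector set \<Rightarrow> ('a \<Rightarrow> 'b::real_normed_vector) \<Rightarrow> bool" where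
  "Ck_on 0 S f \<longleftrightarrow> continuous_on S f"
| "Ck_on (Suc k) S f \<longleftrightarrow>
     (\<forall>x\<in>S. f differentiable (at x)) \<and>
     (\<forall>v. Ck_on k S (\<lambda>x. frechet_derivative f (at x) v))"

definition smooth_on :: "'a::real_normed_vector set \<Rightarrow> ('a \<Rightarrow> 'b::real_normed_vector) \<Rightarrow> bool" where
  "smooth_on S f \<longleftrightarrow> (\<forall>k. Ck_on k S f)"

text \<open>A chart is a pair \<open>(U, \<phi>)\<close>; only the values of \<open>\<phi>\<close> on \<open>U\<close> matter, and \<open>inv_into U \<phi>\<close> is the
  inverse parametrization.\<close>

definition smooth_atlas :: "'g topology \<Rightarrow> ('g set \<times> ('g \<Rightarrow> 'e::euclidean_space)) set \<Rightarrow> bool" where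
  "smooth_atlas X A \<longleftrightarrow>
     (\<Union>(U, \<phi>)\<in>A. U) = topspace X \<and>
     (\<forall>(U, \<phi>)\<in>A. openin X U \<and> open (\<phi> ` U) \<and>
        homeomorphic_map (subtopology X U) (top_of_set (\<phi> ` U)) \<phi>) \<and>
     (\<forall>(U, \<phi>)\<in>A. \<forall>(V, \<psi>)\<in>A. smooth_on (\<phi> ` (U \<inter> V)) (\<psi> \<circ> inv_into U \<phi>))"

definition lie_group ::
    "'g monoid \<Rightarrow> 'g topology \<Rightarrow> ('g set \<times> ('g \<Rightarrow> 'e::euclidean_space)) set \<Rightarrow> bool" where
  "lie_group G X A \<longleftrightarrow>
     group G \<and> topspace X = carrier G \<and> Hausdorff_space X \<and> second_countable X \<and>
     smooth_atlas X A \<and>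
     continuous_map (prod_topology X X) X (\<lambda>(g, h). g \<otimes>\<^bsub>G\<^esub> h) \<and>
     continuous_map X X (\<lambda>g. inv\<^bsub>G\<^esub> g) \<and>
     (\<forall>(U, \<phi>)\<in>A. \<forall>(V, \<psi>)\<in>A. \<forall>(W, \<eta>)\<in>A.
        smooth_on
          {(x, y). x \<in> \<phi> ` U \<and> y \<in> \<psi> ` V \<and> inv_into U \<phi> x \<otimes>\<^bsub>G\<^esub> inv_into V \<psi> y \<in> W}
          (\<lambda>(x, y). \<eta> (inv_into U \<phi> x \<otimes>\<^bsub>G\<^esub> inv_into V \<psi> y))) \<and>
     (\<forall>(U, \<phi>)\<in>A. \<forall>(V, \<psi>)\<in>A.
        smooth_on {x. x \<in> \<phi> ` U \<and> inv\<^bsub>G\<^esub> (inv_into U \<phi> x) \<in> V}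
          (\<lambda>x. \<psi> (inv\<^bsub>G\<^esub> (inv_into U \<phi> x))))"

text \<open>A chart \<open>(U, \<phi>)\<close> around the identity identifies the Lie algebra \<open>\<g> = T\<^sub>1G\<close> with the model
  space \<open>'e\<close>. Then \<open>Ad g\<close> is the differential at \<open>1\<close> of conjugation by \<open>g\<close>, and \<open>[Y, Z] = ad Y Z\<close>,
  where \<open>ad\<close> is the differential of \<open>Ad\<close> at \<open>1\<close>.\<close>

definition Ad :: "'g monoid \<Rightarrow> 'g set \<Rightarrow> ('g \<Rightarrow> 'e::euclidean_space) \<Rightarrow> 'g \<Rightarrow> 'e \<Rightarrow> 'e" where
  "Ad G U \<phi> g =
     frechet_derivative (\<lambda>y. \<phi> (g \<otimes>\<^bsub>G\<^esub> inv_into U \<phi> y \<otimes>\<^bsub>G\<^esub> inv\<^bsub>G\<^esub> g)) (at (\<phi> \<one>\<^bsub>G\<^esub>))"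

definition lie_bracket ::
    "'g monoid \<Rightarrow> 'g set \<Rightarrow> ('g \<Rightarrow> 'e::euclidean_space) \<Rightarrow> 'e \<Rightarrow> 'e \<Rightarrow> 'e" where
  "lie_bracket G U \<phi> Y Z =
     frechet_derivative (\<lambda>x. Ad G U \<phi> (inv_into U \<phi> x) Z) (at (\<phi> \<one>\<^bsub>G\<^esub>)) Y"

text \<open>Semisimplicity of the Lie algebra: the only abelian ideal is \<open>0\<close>. The condition does not
  depend on the chart.\<close>

definition semisimple :: "'g monoid \<Rightarrow> ('g set \<times> ('g \<Rightarrow> 'e::euclidean_space)) set \<Rightarrow> bool" where
  "semisimple G A \<longleftrightarrow>
     (\<forall>(U, \<phi>)\<in>A. \<one>\<^bsub>G\<^esub> \<in> U \<longrightarrow>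
        (\<forall>J. subspace J \<and>
             (\<forall>Y. \<forall>Z\<in>J. lie_bracket G U \<phi> Y Z \<in> J) \<and>
             (\<forall>Y\<in>J. \<forall>Z\<in>J. lie_bracket G U \<phi> Y Z = 0) \<longrightarrow> J = {0}))"


section \<open>Maximal torus, weights, Weyl group, roots\<close>

text \<open>Tori in a Lie group are the compact connected abelian subgroups (these are closed, hence Lie
  subgroups).\<close>

definition torus_in :: "'g monoid \<Rightarrow> 'g topology \<Rightarrow> 'g set \<Rightarrow> bool" where
  "torus_in G X T \<longleftrightarrow>
     subgroup T G \<and> compactin X T \<and> connectedin X T \<and>
     (\<forall>s\<in>T. \<forall>t\<in>T. s \<otimes>\<^bsub>G\<^esub> t = t \<otimes>\<^bsub>G\<^esub> s)"

definition maximal_torus :: "'g monoid \<Rightarrow> 'g topology \<Rightarrow> 'g set \<Rightarrow> bool" where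
  "maximal_torus G X T \<longleftrightarrow>
     torus_in G X T \<and> (\<forall>T'. torus_in G X T' \<and> T \<subseteq> T' \<longrightarrow> T' = T)"

text \<open>The Lie algebra \<open>\<t>\<close> of the torus \<open>T\<close>, with its exponential map \<open>e : \<t> \<rightarrow> T\<close>, is the type \<open>'t\<close>:
  a continuous surjective homomorphism \<open>e\<close> with discrete kernel identifies \<open>\<tau> \<in> 't\<close> with the
  one-parameter subgroup \<open>s \<mapsto> e (s\<tau>)\<close> of \<open>T\<close>, and determines \<open>('t, e)\<close> up to a unique linear
  isomorphism. The norm and inner product of \<open>'t\<close> play no role; \<open>\<t>\<^sup>*\<close> is \<open>'t \<Rightarrow>\<^sub>L real\<close>.\<close>

definition torus_exponential ::
    "'g monoid \<Rightarrow> 'g topology \<Rightarrow> 'g set \<Rightarrow> ('t::euclidean_space \<Rightarrow> 'g) \<Rightarrow> bool" where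
  "torus_exponential G X T e \<longleftrightarrow>
     continuous_map euclidean X e \<and> range e = T \<and>
     (\<forall>\<sigma> \<tau>. e (\<sigma> + \<tau>) = e \<sigma> \<otimes>\<^bsub>G\<^esub> e \<tau>) \<and>
     (\<exists>\<epsilon>>0. \<forall>\<tau>. norm \<tau> < \<epsilon> \<and> e \<tau> = \<one>\<^bsub>G\<^esub> \<longrightarrow> \<tau> = 0)"

definition integral_lattice :: "'g monoid \<Rightarrow> ('t::euclidean_space \<Rightarrow> 'g) \<Rightarrow> 't set" where
  "integral_lattice G e = {\<tau>. e \<tau> = \<one>\<^bsub>G\<^esub>}"

text \<open>The weight \<open>\<nu>\<close> in this lattice corresponds to the character \<open>e \<tau> \<mapsto> exp (2\<pi>i \<nu>(\<tau>))\<close> of \<open>T\<close>.\<close>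

definition weight_lattice ::
    "'g monoid \<Rightarrow> ('t::euclidean_space \<Rightarrow> 'g) \<Rightarrow> ('t \<Rightarrow>\<^sub>L real) set" where
  "weight_lattice G e = {\<nu>. \<forall>\<tau>\<in>integral_lattice G e. blinfun_apply \<nu> \<tau> \<in> \<int>}"

text \<open>The Weyl group \<open>N(T)/T\<close>, through its faithful linear action on \<open>\<t>\<close>: for \<open>n \<in> N(T)\<close>, the map
  \<open>w\<close> below is the differential of conjugation by \<open>n\<close> on \<open>T\<close>.\<close>

definition weyl_group ::
    "'g monoid \<Rightarrow> 'g set \<Rightarrow> ('t::euclidean_space \<Rightarrow> 'g) \<Rightarrow> ('t \<Rightarrow> 't) set" where
  "weyl_group G T e =
     {w. linear w \<and>
         (\<exists>n\<in>carrier G. (\<lambda>t. n \<otimes>\<^bsub>G\<^esub> t \<otimes>\<^bsub>G\<^esub> inv\<^bsub>G\<^esub> n) ` T = T \<and>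
            (\<forall>\<tau>. e (w \<tau>) = n \<otimes>\<^bsub>G\<^esub> e \<tau> \<otimes>\<^bsub>G\<^esub> inv\<^bsub>G\<^esub> n))}"

text \<open>The action on \<open>\<t>\<^sup>*\<close> is \<open>w \<cdot> \<lambda> = \<lambda> \<circ> w\<^sup>-\<^sup>1\<close>, so \<open>\<nu> = w \<cdot> \<lambda>\<close> means \<open>\<nu> \<circ> w = \<lambda>\<close>.\<close>

definition weyl_orbit ::
    "'g monoid \<Rightarrow> 'g set \<Rightarrow> ('t::euclidean_space \<Rightarrow> 'g) \<Rightarrow> ('t \<Rightarrow>\<^sub>L real) \<Rightarrow> ('t \<Rightarrow>\<^sub>L real) set" where
  "weyl_orbit G T e lam =
     {\<nu>. \<exists>w\<in>weyl_group G T e. \<forall>\<tau>. blinfun_apply \<nu> (w \<tau>) = blinfun_apply lam \<tau>}"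

definition weyl_polytope ::
    "'g monoid \<Rightarrow> 'g set \<Rightarrow> ('t::euclidean_space \<Rightarrow> 'g) \<Rightarrow> ('t \<Rightarrow>\<^sub>L real) \<Rightarrow> ('t \<Rightarrow>\<^sub>L real) set" where
  "weyl_polytope G T e lam = convex hull (weyl_orbit G T e lam)"

text \<open>Roots are the nonzero weights of \<open>Ad\<close> on \<open>\<g> \<otimes> \<complex> = \<g> \<oplus> i\<g>\<close>. With \<open>c = cos (2\<pi> \<alpha>(\<tau>))\<close> and
  \<open>s = sin (2\<pi> \<alpha>(\<tau>))\<close>, the two equations are the real and imaginary part of
  \<open>Ad (e \<tau>) (P + iQ) = (c + is) (P + iQ)\<close>.\<close>

definition roots ::
    "'g monoid \<Rightarrow> ('g set \<times> ('g \<Rightarrow> 'e::euclidean_space)) set \<Rightarrow> ('t::euclidean_space \<Rightarrow> 'g)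
     \<Rightarrow> ('t \<Rightarrow>\<^sub>L real) set" where
  "roots G A e =
     {\<alpha>. \<alpha> \<noteq> 0 \<and>
        (\<exists>(U, \<phi>)\<in>A. \<one>\<^bsub>G\<^esub> \<in> U \<and>
          (\<exists>P Q. (P, Q) \<noteq> (0, 0) \<and>
            (\<forall>\<tau>. let c = cos (2 * pi * blinfun_apply \<alpha> \<tau>);
                     s = sin (2 * pi * blinfun_apply \<alpha> \<tau>)
                 in Ad G U \<phi> (e \<tau>) P = c *\<^sub>R P - s *\<^sub>R Q \<and>
                    Ad G U \<phi> (e \<tau>) Q = s *\<^sub>R P + c *\<^sub>R Q)))}"

text \<open>The coroot of a root \<open>\<alpha>\<close> is the unique \<open>h \<in> \<t>\<close> with \<open>\<alpha>(h) = 2\<close> whose reflection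
  \<open>s\<^sub>\<alpha> : \<tau> \<mapsto> \<tau> - \<alpha>(\<tau>) h\<close> belongs to the Weyl group; on \<open>\<t>\<^sup>*\<close> one has \<open>s\<^sub>\<alpha> \<nu> = \<nu> - \<nu>(h) \<alpha>\<close>, so the wall
  of \<open>\<alpha>\<close> in \<open>\<t>\<^sup>*\<close> is \<open>{\<nu>. \<nu>(h) = 0}\<close>.\<close>

definition is_coroot ::
    "'g monoid \<Rightarrow> 'g set \<Rightarrow> ('t::euclidean_space \<Rightarrow> 'g) \<Rightarrow> ('t \<Rightarrow>\<^sub>L real) \<Rightarrow> 't \<Rightarrow> bool" where
  "is_coroot G T e \<alpha> h \<longleftrightarrow>
     blinfun_apply \<alpha> h = 2 \<and> (\<lambda>\<tau>. \<tau> - blinfun_apply \<alpha> \<tau> *\<^sub>R h) \<in> weyl_group G T e"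

definition weyl_chamber ::
    "'g monoid \<Rightarrow> ('g set \<times> ('g \<Rightarrow> 'e::euclidean_space)) set \<Rightarrow> 'g set
     \<Rightarrow> ('t::euclidean_space \<Rightarrow> 'g) \<Rightarrow> ('t \<Rightarrow>\<^sub>L real) set \<Rightarrow> bool" where
  "weyl_chamber G A T e C \<longleftrightarrow>
     C \<in> components {\<nu>. \<forall>\<alpha>\<in>roots G A e. \<forall>h. is_coroot G T e \<alpha> h \<longrightarrow> blinfun_apply \<nu> h \<noteq> 0}"

definition dominant_weights ::
    "'g monoid \<Rightarrow> ('t::euclidean_space \<Rightarrow> 'g) \<Rightarrow> ('t \<Rightarrow>\<^sub>L real) set \<Rightarrow> ('t \<Rightarrow>\<^sub>L real) set" where
  "dominant_weights G e C = weight_lattice G e \<inter> closure C"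

definition positive_roots ::
    "'g monoid \<Rightarrow> ('g set \<times> ('g \<Rightarrow> 'e::euclidean_space)) set \<Rightarrow> 'g set
     \<Rightarrow> ('t::euclidean_space \<Rightarrow> 'g) \<Rightarrow> ('t \<Rightarrow>\<^sub>L real) set \<Rightarrow> ('t \<Rightarrow>\<^sub>L real) set" where
  "positive_roots G A T e C =
     {\<alpha>\<in>roots G A e. \<exists>h. is_coroot G T e \<alpha> h \<and> (\<forall>\<nu>\<in>C. blinfun_apply \<nu> h > 0)}"


section \<open>Representations and their tensor powers\<close>

definition representation ::
    "'g monoid \<Rightarrow> 'g topology \<Rightarrow> ('g \<Rightarrow> complex^'n^'n) \<Rightarrow> bool" where
  "representation G X \<rho> \<longleftrightarrow>
     continuous_map X euclidean \<rho> \<and> \<rho> \<one>\<^bsub>G\<^esub> = mat 1 \<and>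
     (\<forall>g\<in>carrier G. \<forall>h\<in>carrier G. \<rho> (g \<otimes>\<^bsub>G\<^esub> h) = \<rho> g ** \<rho> h)"

definition irreducible_representation ::
    "'g monoid \<Rightarrow> 'g topology \<Rightarrow> ('g \<Rightarrow> complex^'n^'n) \<Rightarrow> bool" where
  "irreducible_representation G X \<rho> \<longleftrightarrow>
     representation G X \<rho> \<and>
     (\<forall>S. vec.subspace S \<and> (\<forall>g\<in>carrier G. \<forall>v\<in>S. \<rho> g *v v \<in> S) \<longrightarrow> S = {0} \<or> S = UNIV)"

text \<open>The tensor power \<open>(\<complex>\<^sup>n)\<^bsup>\<otimes>N\<^esup>\<close> consists of the coefficient functions with respect to the basis
  \<open>e\<^bsub>i\<^sub>1\<^esub> \<otimes> \<dots> \<otimes> e\<^bsub>i\<^sub>N\<^esub>\<close>, that is, the functions supported on index lists of length \<open>N\<close>.\<close>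

definition tensor_power :: "nat \<Rightarrow> ('n list \<Rightarrow> complex) set" where
  "tensor_power N = {u. \<forall>is. length is \<noteq> N \<longrightarrow> u is = 0}"

definition tensor_action ::
    "nat \<Rightarrow> complex^'n^'n \<Rightarrow> ('n::finite list \<Rightarrow> complex) \<Rightarrow> ('n list \<Rightarrow> complex)" where
  "tensor_action N B u =
     (\<lambda>is. if length is = N
           then \<Sum>js | length js = N. (\<Prod>k<N. B $ (is ! k) $ (js ! k)) * u js
           else 0)"

definition weight_space ::
    "('t::euclidean_space \<Rightarrow> 'g) \<Rightarrow> ('g \<Rightarrow> complex^'n^'n) \<Rightarrow> nat \<Rightarrow> ('t \<Rightarrow>\<^sub>L real)
     \<Rightarrow> ('n::finite list \<Rightarrow> complex) set" where
  "weight_space e \<rho> N \<nu> =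
     {u\<in>tensor_power N.
        \<forall>\<tau>. tensor_action N (\<rho> (e \<tau>)) u = (\<lambda>is. cis (2 * pi * blinfun_apply \<nu> \<tau>) * u is)}"

definition weight_mult ::
    "('t::euclidean_space \<Rightarrow> 'g) \<Rightarrow> ('g \<Rightarrow> complex^'n^'n) \<Rightarrow> nat \<Rightarrow> ('t \<Rightarrow>\<^sub>L real) \<Rightarrow> nat" where
  "weight_mult e \<rho> N \<nu> =
     vector_space.dim (\<lambda>(c::complex) u is. c * u is) (weight_space e \<rho> N \<nu>)"

definition weights ::
    "'g monoid \<Rightarrow> ('t::euclidean_space \<Rightarrow> 'g) \<Rightarrow> ('g \<Rightarrow> complex^'n^'n) \<Rightarrow> ('t \<Rightarrow>\<^sub>L real) set" where
  "weights G e \<rho> = {\<mu>\<in>weight_lattice G e. weight_mult e \<rho> 1 \<mu> \<noteq> 0}"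

text \<open>\<open>lam\<close> is the largest weight in the partial order given by: \<open>\<mu> \<le> \<nu>\<close> iff \<open>\<nu> - \<mu>\<close> is a sum of positive
  roots with coefficients in \<open>\<nat>\<close>.\<close>

definition highest_weight ::
    "'g monoid \<Rightarrow> ('g set \<times> ('g \<Rightarrow> 'e::euclidean_space)) set \<Rightarrow> 'g set
     \<Rightarrow> ('t::euclidean_space \<Rightarrow> 'g) \<Rightarrow> ('t \<Rightarrow>\<^sub>L real) set \<Rightarrow> ('g \<Rightarrow> complex^'n^'n)
     \<Rightarrow> ('t \<Rightarrow>\<^sub>L real) \<Rightarrow> bool" where
  "highest_weight G A T e C \<rho> lam \<longleftrightarrow>
     lam \<in> weights G e \<rho> \<and>
     (\<forall>\<mu>\<in>weights G e \<rho>. \<exists>k::('t \<Rightarrow>\<^sub>L real) \<Rightarrow> nat.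
        lam - \<mu> = (\<Sum>\<alpha>\<in>positive_roots G A T e C. real (k \<alpha>) *\<^sub>R \<alpha>))"


section \<open>The measures, the rate function, and the large deviation principle\<close>

text \<open>The image under \<open>\<nu> \<mapsto> N\<^sup>-\<^sup>1\<nu>\<close> of the measure with mass \<open>m\<^sub>N(\<lambda>; \<nu>) / (dim V\<^sub>\<lambda>)\<^sup>N\<close> at each
  \<open>\<nu> \<in> Q(N\<lambda>) \<inter> I\<^sup>*\<close>, that is, the corresponding weighted sum of Dirac measures on \<open>Q(\<lambda>)\<close>.\<close>

definition weight_measure ::
    "'g monoid \<Rightarrow> 'g set \<Rightarrow> ('t::euclidean_space \<Rightarrow> 'g) \<Rightarrow> ('g \<Rightarrow> complex^'n^'n)
     \<Rightarrow> ('t \<Rightarrow>\<^sub>L real) \<Rightarrow> nat \<Rightarrow> ('t \<Rightarrow>\<^sub>L real) measure" where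
  "weight_measure G T e \<rho> lam N =
     distr
       (point_measure (weyl_polytope G T e (real N *\<^sub>R lam) \<inter> weight_lattice G e)
          (\<lambda>\<nu>. ennreal (real (weight_mult e \<rho> N \<nu>) / real CARD('n) ^ N)))
       (restrict_space borel (weyl_polytope G T e lam))
       (\<lambda>\<nu>. (1 / real N) *\<^sub>R \<nu>)"

definition rate_function ::
    "'g monoid \<Rightarrow> ('t::euclidean_space \<Rightarrow> 'g) \<Rightarrow> ('g \<Rightarrow> complex^'n^'n) \<Rightarrow> ('t \<Rightarrow>\<^sub>L real) \<Rightarrow> ereal" where
  "rate_function G e \<rho> x =
     (SUP \<tau>. ereal (blinfun_apply x \<tau> -
        ln ((\<Sum>\<nu>\<in>weights G e \<rho>. real (weight_mult e \<rho> 1 \<nu>) * exp (blinfun_apply \<nu> \<tau>))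
            / real CARD('n))))"

definition log_ereal :: "real \<Rightarrow> ereal" where
  "log_ereal p = (if p \<le> 0 then -\<infinity> else ereal (ln p))"

text \<open>Large deviation principle with speed \<open>N\<close> for measures \<open>m\<^sub>1, m\<^sub>2, \<dots>\<close> on the closed set \<open>E\<close>; the
  value \<open>m 0\<close> is irrelevant. Closed and open subsets of \<open>E\<close> are meant in the relative topology.\<close>

definition large_deviation_principle ::
    "'a::topological_space set \<Rightarrow> (nat \<Rightarrow> 'a measure) \<Rightarrow> ('a \<Rightarrow> ereal) \<Rightarrow> bool" where
  "large_deviation_principle E m J \<longleftrightarrow>
     closed E \<and>
     (\<forall>N\<ge>1. prob_space (m N) \<and> space (m N) = E \<and> sets (m N) = sets (restrict_space borel E)) \<and>
     (\<forall>x\<in>E. 0 \<le> J x) \<and>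
     (\<forall>c::ereal. closedin (top_of_set E) {x\<in>E. J x \<le> c}) \<and>
     (\<forall>c::real. compact {x\<in>E. 0 \<le> J x \<and> J x \<le> ereal c}) \<and>
     (\<forall>F. closedin (top_of_set E) F \<longrightarrow>
        limsup (\<lambda>N. ereal (1 / real N) * log_ereal (measure (m N) F)) \<le> - (INF x\<in>F. J x)) \<and>
     (\<forall>U. openin (top_of_set E) U \<longrightarrow>
        - (INF x\<in>U. J x) \<le> liminf (\<lambda>N. ereal (1 / real N) * log_ereal (measure (m N) U)))"

end

theory Submission
  imports Defs "HOL-Computational_Algebra.Fundamental_Theorem_Algebra"
begin

text \<open>
  The measure of weight multiplicities of \<open>V\<^sub>\<lambda>\<^bsup>\<otimes>N\<^esup>\<close> is the law of the mean of \<open>N\<close> independent uniform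
  choices from the list of weights of \<open>V\<^sub>\<lambda>\<close>, so the theorem is Cramer's theorem for a finitely
  supported distribution on \<open>\<t>\<^sup>*\<close>, once two facts of representation theory are in place.

  First, restricted to the torus, \<open>\<rho>\<close> is a continuous bounded representation of the vector group
  \<open>\<t>\<close>; hence it is diagonalizable, with characters \<open>\<tau> \<mapsto> exp (2\<pi>i \<mu>\<^sub>i(\<tau>))\<close>, where \<open>i\<close> runs over the
  index type \<open>'n\<close> (\<open>bounded_group_diagonalizable\<close>). In the product basis the weight of
  \<open>v\<^sub>i\<^sub>1 \<otimes> \<dots> \<otimes> v\<^sub>i\<^sub>N\<close> is \<open>\<mu>\<^sub>i\<^sub>1 + \<dots> + \<mu>\<^sub>i\<^sub>N\<close>, so \<open>m\<^sub>N(\<lambda>; \<nu>)\<close> counts the words \<open>i\<^sub>1 \<dots> i\<^sub>N\<close> whose weights add up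
  to \<open>\<nu>\<close> (\<open>weight_mult_eq_card\<close>).

  Second, the convex hull of the weights is \<open>Q(\<lambda>)\<close> (\<open>weyl_polytope_eq_hull_weights\<close>). This makes the
  measures probability measures. The Weyl group permutes the weights, so the orbit of \<open>\<lambda>\<close> consists of
  weights. Conversely let \<open>\<mu>\<close> be a weight and \<open>\<tau> \<in> \<t>\<close>. Moving \<open>\<tau>\<close> by the Weyl group almost into the
  dominant chamber and using that \<open>\<lambda> - w\<mu>\<close> is a nonnegative combination of positive roots gives
  \<open>\<mu>(\<tau>) \<le> (w\<^sup>-\<^sup>1\<lambda>)(\<tau>)\<close> up to an arbitrarily small error, which disappears because the orbit is finite;
  and a point that no \<open>\<tau>\<close> separates from the orbit lies in its hull. The element \<open>w\<close> is an
  approximate maximizer of \<open>\<nu>\<^sub>0(w\<tau>)\<close>, where \<open>\<nu>\<^sub>0\<close> is a point of the chamber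
  (\<open>weyl_conjugate_almost_dominant\<close>); it exists because the compactness of \<open>G\<close> makes the Weyl group
  bounded (\<open>weyl_group_bounded\<close>).

  In Cramer's theorem the upper bound is Chernoff's inequality and compactness. For the lower bound at a
  point \<open>x\<close> of the hull, which may lie on the boundary, where no exponential tilting has mean \<open>x\<close>, one
  maximizes \<open>x(\<tau>) - \<Lambda>(\<tau>) - \<epsilon>|\<tau>|\<^sup>2/2\<close> instead of \<open>x(\<tau>) - \<Lambda>(\<tau>)\<close>. The maximum is attained, and tilting by the
  maximizer gives a mean near \<open>x\<close> at no greater cost (\<open>exists_tilted_mean_near\<close>).
\<close>

section \<open>Sums over words\<close>

definition words :: "nat \<Rightarrow> 'n list set" where
  "words N = {is. length is = N}"

lemma words_0 [simp]: "words 0 = {[]}"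
  by (auto simp: words_def)

lemma finite_words [simp, intro]: "finite (words N :: 'n::finite list set)"
  using finite_lists_length_eq[of "UNIV :: 'n set" N] by (simp add: words_def)

lemma card_words: "card (words N :: 'n::finite list set) = CARD('n) ^ N"
  using card_lists_length_eq[of "UNIV :: 'n set" N] by (simp add: words_def)

lemma sum_words_Suc:
  fixes f :: "'n::finite list \<Rightarrow> 'a::comm_monoid_add"
  shows "sum f (words (Suc N)) = (\<Sum>i\<in>UNIV. \<Sum>is\<in>words N. f (i # is))"
proof -
  have "words (Suc N) = (\<lambda>(i::'n, is). i # is) ` (UNIV \<times> words N)"
    by (force simp: words_def length_Suc_conv)
  then have "sum f (words (Suc N)) = (\<Sum>(i, is)\<in>UNIV \<times> words N. f (i # is))"
    by (simp add: sum.reindex inj_on_def case_prod_unfold)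
  then show ?thesis by (simp add: sum.cartesian_product)
qed

lemma sum_words_prod_list:
  fixes p :: "'n::finite \<Rightarrow> 'a::comm_semiring_1"
  shows "(\<Sum>is\<in>words N. prod_list (map p is)) = (\<Sum>i\<in>UNIV. p i) ^ N"
  by (induction N) (simp_all add: sum_words_Suc sum_distrib_left[symmetric] sum_distrib_right[symmetric])

text \<open>A word is weighted by the product of its letter weights, so the letters are independent and the
  variances of the centred letters add: in the expansion of the square the mixed terms vanish.\<close>

lemma second_moment_words:
  fixes p z :: "'n::finite \<Rightarrow> real"
  assumes p: "(\<Sum>i\<in>UNIV. p i) = 1" and z: "(\<Sum>i\<in>UNIV. p i * z i) = 0"
  shows "(\<Sum>is\<in>words N. prod_list (map p is) * (sum_list (map z is))\<^sup>2)
           = real N * (\<Sum>i\<in>UNIV. p i * (z i)\<^sup>2)"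
proof (induction N)
  case (Suc N)
  have mean: "(\<Sum>is\<in>words N. prod_list (map p is) * (p i * z i * (2 * sum_list (map z is))))
              = p i * z i * (\<Sum>is\<in>words N. prod_list (map p is) * (2 * sum_list (map z is)))" for i
    by (simp add: sum_distrib_left mult_ac)
  have "(\<Sum>is\<in>words (Suc N). prod_list (map p is) * (sum_list (map z is))\<^sup>2)
      = (\<Sum>i\<in>UNIV. \<Sum>is\<in>words N.
           p i * (z i)\<^sup>2 * prod_list (map p is)
           + prod_list (map p is) * (p i * z i * (2 * sum_list (map z is)))
           + p i * (prod_list (map p is) * (sum_list (map z is))\<^sup>2))"
    unfolding sum_words_Suc by (intro sum.cong refl) (simp add: power2_eq_square algebra_simps)
  also have "\<dots> = (\<Sum>i\<in>UNIV. p i * (z i)\<^sup>2)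
      + real N * (\<Sum>i\<in>UNIV. p i * (z i)\<^sup>2)"
    unfolding sum.distrib mean
    by (simp add: sum_distrib_left[symmetric] sum_distrib_right[symmetric]
        sum_words_prod_list p z Suc.IH)
  finally show ?case by (simp add: algebra_simps)
qed simp

section \<open>Cramer's theorem for finitely many points\<close>

definition mean_prob ::
    "('n::finite \<Rightarrow> 't::euclidean_space \<Rightarrow>\<^sub>L real) \<Rightarrow> nat \<Rightarrow> ('t \<Rightarrow>\<^sub>L real) set \<Rightarrow> real" where
  "mean_prob mu N F =
     real (card {is\<in>words N. (1 / real N) *\<^sub>R sum_list (map mu is) \<in> F}) / real CARD('n) ^ N"

text \<open>The function \<open>\<Lambda>\<close> whose Legendre transform is the rate function.\<close>

definition log_mgf :: "('n::finite \<Rightarrow> 't::euclidean_space \<Rightarrow>\<^sub>L real) \<Rightarrow> 't \<Rightarrow> real" where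
  "log_mgf mu \<tau> = ln ((\<Sum>i\<in>UNIV. exp (blinfun_apply (mu i) \<tau>)) / real CARD('n))"

lemma exp_log_mgf:
  fixes mu :: "'n::finite \<Rightarrow> 't::euclidean_space \<Rightarrow>\<^sub>L real"
  shows "real CARD('n) * exp (log_mgf mu \<tau>) = (\<Sum>i\<in>UNIV. exp (blinfun_apply (mu i) \<tau>))"
proof -
  have "0 < (\<Sum>i\<in>UNIV. exp (blinfun_apply (mu i) \<tau>)) / real CARD('n)"
    by (intro divide_pos_pos sum_pos) auto
  then show ?thesis by (simp add: log_mgf_def)
qed

lemma blinfun_apply_sum_list:
  "blinfun_apply (sum_list (map mu is)) \<tau> = (\<Sum>i\<leftarrow>is. blinfun_apply (mu i) \<tau>)"
  by (induction "is") (simp_all add: blinfun.add_left)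

lemma exp_sum_list: "exp (\<Sum>i\<leftarrow>is. f i :: real) = (\<Prod>i\<leftarrow>is. exp (f i))"
  by (induction "is") (simp_all add: exp_add)

lemma sum_words_exp:
  fixes mu :: "'n::finite \<Rightarrow> 't::euclidean_space \<Rightarrow>\<^sub>L real"
  shows "(\<Sum>is\<in>words N. exp (blinfun_apply (sum_list (map mu is)) \<tau>))
           = real CARD('n) ^ N * exp (real N * log_mgf mu \<tau>)"
  by (simp add: blinfun_apply_sum_list exp_sum_list sum_words_prod_list
      exp_log_mgf[symmetric] power_mult_distrib exp_of_nat_mult)

lemma mean_prob_nonneg: "0 \<le> mean_prob mu N F"
  by (simp add: mean_prob_def)

lemma mean_prob_mono: "F \<subseteq> F' \<Longrightarrow> mean_prob mu N F \<le> mean_prob mu N F'"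
  unfolding mean_prob_def
  by (intro divide_right_mono of_nat_mono card_mono) (auto intro: finite_subset[OF _ finite_words])

lemma mean_prob_UN_le:
  assumes "finite K"
  shows "mean_prob mu N (\<Union>k\<in>K. B k) \<le> (\<Sum>k\<in>K. mean_prob mu N (B k))"
proof -
  have "card {is\<in>words N. (1 / real N) *\<^sub>R sum_list (map mu is) \<in> (\<Union>k\<in>K. B k)}
      = card (\<Union>k\<in>K. {is\<in>words N. (1 / real N) *\<^sub>R sum_list (map mu is) \<in> B k})"
    by (rule arg_cong[where f = card]) auto
  also have "\<dots> \<le> (\<Sum>k\<in>K. card {is\<in>words N. (1 / real N) *\<^sub>R sum_list (map mu is) \<in> B k})"
    by (rule card_UN_le[OF assms])
  finally show ?thesis
    unfolding mean_prob_def sum_divide_distrib[symmetric] of_nat_sum[symmetric]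
    by (intro divide_right_mono of_nat_mono) auto
qed

text \<open>Chernoff's inequality: compare the indicator function of the half space with an exponential.\<close>

lemma chernoff_bound:
  fixes mu :: "'n::finite \<Rightarrow> 't::euclidean_space \<Rightarrow>\<^sub>L real"
  assumes N: "N \<ge> 1"
  shows "mean_prob mu N {y. c < blinfun_apply y \<tau> - log_mgf mu \<tau>} \<le> exp (- (real N * c))"
proof -
  define S where "S = {is\<in>words N. c < blinfun_apply ((1 / real N) *\<^sub>R sum_list (map mu is)) \<tau> - log_mgf mu \<tau>}"
  let ?L = "log_mgf mu \<tau>"
  have fS: "finite S" "S \<subseteq> words N" by (auto simp: S_def)
  have "real (card S) = (\<Sum>is\<in>S. 1)" by simp
  also have "\<dots> \<le> (\<Sum>is\<in>S. exp (blinfun_apply (sum_list (map mu is)) \<tau>) * exp (- (real N * ?L) - real N * c))"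
  proof (intro sum_mono)
    fix "is" assume "is \<in> S"
    then have "c < (1 / real N) * blinfun_apply (sum_list (map mu is)) \<tau> - ?L"
      by (simp add: S_def blinfun.scaleR_left)
    then have "real N * c \<le> real N * ((1 / real N) * blinfun_apply (sum_list (map mu is)) \<tau> - ?L)"
      by (intro mult_left_mono) auto
    then have "0 \<le> blinfun_apply (sum_list (map mu is)) \<tau> + (- (real N * ?L) - real N * c)"
      using N by (simp add: algebra_simps)
    then show "1 \<le> exp (blinfun_apply (sum_list (map mu is)) \<tau>) * exp (- (real N * ?L) - real N * c)"
      by (simp add: exp_add[symmetric])
  qed
  also have "\<dots> \<le> (\<Sum>is\<in>words N. exp (blinfun_apply (sum_list (map mu is)) \<tau>) * exp (- (real N * ?L) - real N * c))"
    using fS by (intro sum_mono2) auto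
  also have "\<dots> = real CARD('n) ^ N * exp (- (real N * c))"
    unfolding sum_distrib_right[symmetric] sum_words_exp
    by (simp only: mult.assoc exp_add[symmetric]) simp
  finally have "real (card S) \<le> real CARD('n) ^ N * exp (- (real N * c))" .
  moreover have "mean_prob mu N {y. c < blinfun_apply y \<tau> - log_mgf mu \<tau>} = real (card S) / real CARD('n) ^ N"
    by (simp add: mean_prob_def S_def)
  ultimately show ?thesis by (simp add: divide_le_eq mult.commute)
qed

text \<open>Reduces norm estimates on the dual space to its coordinates, so that Chebyshev's inequality can be
  used coordinatewise.\<close>

lemma norm_blinfun_square_le:
  fixes \<nu> :: "'t::euclidean_space \<Rightarrow>\<^sub>L real"
  shows "(norm \<nu>)\<^sup>2 \<le> real DIM('t) * (\<Sum>b\<in>Basis. (blinfun_apply \<nu> b)\<^sup>2)"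
proof -
  have "norm \<nu> \<le> (\<Sum>b\<in>Basis. \<bar>blinfun_apply \<nu> b\<bar>)"
    using norm_blinfun_euclidean_le[of \<nu>] by simp
  then have "(norm \<nu>)\<^sup>2 \<le> (\<Sum>b\<in>Basis. \<bar>blinfun_apply \<nu> b\<bar>)\<^sup>2"
    by (intro power_mono) auto
  also have "\<dots> \<le> real DIM('t) * (\<Sum>b\<in>Basis. \<bar>blinfun_apply \<nu> b\<bar>\<^sup>2)"
    using Cauchy_Schwarz_ineq_sum[of "\<lambda>_. 1" "\<lambda>b. \<bar>blinfun_apply \<nu> b\<bar>" Basis] by simp
  finally show ?thesis by simp
qed

text \<open>The weak law of large numbers, by Chebyshev's inequality.\<close>

lemma weak_law_words:
  fixes mu :: "'n::finite \<Rightarrow> 't::euclidean_space \<Rightarrow>\<^sub>L real" and p :: "'n \<Rightarrow> real"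
  assumes p0: "\<And>i. 0 \<le> p i" and p1: "(\<Sum>i\<in>UNIV. p i) = 1" and \<delta>: "\<delta> > 0"
  defines "y \<equiv> \<Sum>i\<in>UNIV. p i *\<^sub>R mu i"
  shows "\<exists>N0. \<forall>N\<ge>N0. 1 / 2 \<le> (\<Sum>is | is \<in> words N \<and> (1 / real N) *\<^sub>R sum_list (map mu is) \<in> ball y \<delta>. prod_list (map p is))"
proof -
  define z where "z b i = blinfun_apply (mu i - y) b" for b i
  \<comment> \<open>Chebyshev bounds the mass outside the ball by \<open>K / N\<close>\<close>
  define K where "K = real DIM('t) * (\<Sum>b\<in>Basis. \<Sum>i\<in>UNIV. p i * (z b i)\<^sup>2) / \<delta>\<^sup>2"
  have z_mean: "(\<Sum>i\<in>UNIV. p i * z b i) = 0" for b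
    by (simp add: z_def y_def blinfun.diff_left blinfun.sum_left blinfun.scaleR_left
        right_diff_distrib sum_subtractf sum_distrib_right[symmetric] p1)
  have pp: "0 \<le> prod_list (map p is)" for "is" by (induction "is") (auto simp: p0)
  have main: "1 / 2 \<le> (\<Sum>is | is \<in> words N \<and> (1 / real N) *\<^sub>R sum_list (map mu is) \<in> ball y \<delta>. prod_list (map p is))"
    if N: "real N \<ge> 2 * K" "N \<ge> 1" for N
  proof -
    define A where "A = {is\<in>words N. (1 / real N) *\<^sub>R sum_list (map mu is) \<in> ball y \<delta>}"
    have fin: "finite (words N - A)" by simp
    have "(\<Sum>is\<in>words N - A. prod_list (map p is))
       \<le> (\<Sum>is\<in>words N - A. prod_list (map p is) * (real DIM('t) / (real N * \<delta>)\<^sup>2 * (\<Sum>b\<in>Basis. (sum_list (map (z b) is))\<^sup>2)))"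
    proof (intro sum_mono)
      fix "is" assume memb: "is \<in> words N - A"
      let ?v = "sum_list (map mu is) - real N *\<^sub>R y"
      have vb: "blinfun_apply ?v b = sum_list (map (z b) is)" for b
      proof -
        have "length is = N" using memb by (auto simp: words_def)
        moreover have "blinfun_apply (sum_list (map mu js) - real (length js) *\<^sub>R y) b = sum_list (map (z b) js)" for js
          by (induction js) (simp_all add: z_def blinfun.add_left blinfun.diff_left blinfun.scaleR_left algebra_simps)
        ultimately show ?thesis by blast
      qed
      have "dist y ((1 / real N) *\<^sub>R sum_list (map mu is)) \<ge> \<delta>"
        using memb by (auto simp: A_def not_less)
      moreover have "(1 / real N) *\<^sub>R sum_list (map mu is) - y = (1 / real N) *\<^sub>R ?v"
        using N by (simp add: algebra_simps)
      ultimately have "\<delta> \<le> (1 / real N) * norm ?v"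
        by (metis abs_of_nonneg dist_commute dist_norm norm_scaleR of_nat_0_le_iff zero_le_divide_1_iff)
      then have "real N * \<delta> \<le> norm ?v" using N by (simp add: field_simps)
      then have "(real N * \<delta>)\<^sup>2 \<le> (norm ?v)\<^sup>2" using \<delta> by (intro power_mono) auto
      also have "\<dots> \<le> real DIM('t) * (\<Sum>b\<in>Basis. (sum_list (map (z b) is))\<^sup>2)"
        using norm_blinfun_square_le[of ?v] by (simp only: vb)
      finally have "1 \<le> real DIM('t) / (real N * \<delta>)\<^sup>2 * (\<Sum>b\<in>Basis. (sum_list (map (z b) is))\<^sup>2)"
        using N \<delta> by (simp add: field_simps)
      then show "prod_list (map p is) \<le> prod_list (map p is) * (real DIM('t) / (real N * \<delta>)\<^sup>2 * (\<Sum>b\<in>Basis. (sum_list (map (z b) is))\<^sup>2))"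
        using mult_left_mono[OF _ pp[of "is"]] by fastforce
    qed
    also have "\<dots> \<le> (\<Sum>is\<in>words N. prod_list (map p is) * (real DIM('t) / (real N * \<delta>)\<^sup>2 * (\<Sum>b\<in>Basis. (sum_list (map (z b) is))\<^sup>2)))"
      by (intro sum_mono2 mult_nonneg_nonneg divide_nonneg_nonneg sum_nonneg pp) auto
    also have "\<dots> = real DIM('t) / (real N * \<delta>)\<^sup>2 * (\<Sum>b\<in>Basis. \<Sum>is\<in>words N. prod_list (map p is) * (sum_list (map (z b) is))\<^sup>2)"
      by (subst sum.swap) (simp add: sum_distrib_left sum_divide_distrib mult_ac)
    also have "\<dots> = K / real N"
      unfolding second_moment_words[OF p1 z_mean] K_def sum_distrib_left[symmetric]
      using N by (simp add: power2_eq_square)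
    also have "\<dots> \<le> 1 / 2" using N by (simp add: field_simps)
    finally have "(\<Sum>is\<in>words N - A. prod_list (map p is)) \<le> 1 / 2" .
    moreover have "(\<Sum>is\<in>words N. prod_list (map p is)) = 1"
      by (simp add: sum_words_prod_list p1)
    moreover have "(\<Sum>is\<in>words N. prod_list (map p is)) = (\<Sum>is\<in>words N - A. prod_list (map p is)) + (\<Sum>is\<in>A. prod_list (map p is))"
      by (rule sum.subset_diff) (auto simp: A_def)
    ultimately show ?thesis by (simp add: A_def)
  qed
  show ?thesis
  proof (intro exI allI impI)
    fix N assume "N \<ge> max 1 (nat \<lceil>2 * K\<rceil>)"
    then show "1 / 2 \<le> (\<Sum>is | is \<in> words N \<and> (1 / real N) *\<^sub>R sum_list (map mu is) \<in> ball y \<delta>. prod_list (map p is))"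
      by (intro main) linarith+
  qed
qed

text \<open>Under the tilted weights, proportional to \<open>exp (mu i \<tau>)\<close>, the mean concentrates at \<open>y\<close>. On the ball
  around \<open>y\<close> the density of the tilted law with respect to the uniform one is at most the
  exponential of \<open>N\<close> times the rate, up to the oscillation \<open>\<delta> * norm \<tau>\<close> of \<open>\<tau>\<close> on the ball.\<close>

lemma tilted_lower_bound:
  fixes mu :: "'n::finite \<Rightarrow> 't::euclidean_space \<Rightarrow>\<^sub>L real" and \<tau> :: 't
  assumes \<delta>: "\<delta> > 0"
  defines "y \<equiv> \<Sum>i\<in>UNIV. (exp (blinfun_apply (mu i) \<tau>) / (\<Sum>j\<in>UNIV. exp (blinfun_apply (mu j) \<tau>))) *\<^sub>R mu i"
  shows "\<exists>N0. \<forall>N\<ge>N0.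
    exp (- (real N * (blinfun_apply y \<tau> - log_mgf mu \<tau> + \<delta> * norm \<tau>))) / 2 \<le> mean_prob mu N (ball y \<delta>)"
proof -
  define Z where "Z = (\<Sum>j\<in>UNIV. exp (blinfun_apply (mu j) \<tau>))"
  define p where "p i = exp (blinfun_apply (mu i) \<tau>) / Z" for i
  have Z: "Z > 0" unfolding Z_def by (intro sum_pos) auto
  have Z_eq: "Z = real CARD('n) * exp (log_mgf mu \<tau>)" by (simp add: Z_def exp_log_mgf)
  have p: "0 \<le> p i" for i using Z by (simp add: p_def)
  have p1: "(\<Sum>i\<in>UNIV. p i) = 1"
    using Z unfolding p_def sum_divide_distrib[symmetric] Z_def by simp
  have y: "y = (\<Sum>i\<in>UNIV. p i *\<^sub>R mu i)" by (simp add: y_def p_def Z_def)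
  obtain N0 where N0: "\<And>N. N \<ge> N0 \<Longrightarrow> 1 / 2 \<le> (\<Sum>is | is \<in> words N \<and> (1 / real N) *\<^sub>R sum_list (map mu is) \<in> ball y \<delta>. prod_list (map p is))"
    using weak_law_words[OF p p1 \<delta>] y by blast
  have prod_p: "prod_list (map p is) = exp (blinfun_apply (sum_list (map mu is)) \<tau>) / Z ^ length is" for "is"
    by (induction "is") (simp_all add: p_def blinfun.add_left exp_add)
  show ?thesis
  proof (intro exI allI impI)
    fix N assume N: "N \<ge> max 1 N0"
    define A where "A = {is\<in>words N. (1 / real N) *\<^sub>R sum_list (map mu is) \<in> ball y \<delta>}"
    let ?r = "blinfun_apply y \<tau> + \<delta> * norm \<tau>"
    have "1 / 2 \<le> (\<Sum>is\<in>A. prod_list (map p is))" using N0[of N] N by (simp add: A_def)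
    also have "\<dots> \<le> (\<Sum>is\<in>A. exp (real N * ?r) / Z ^ N)"
    proof (intro sum_mono)
      fix "is" assume memb: "is \<in> A"
      let ?a = "(1 / real N) *\<^sub>R sum_list (map mu is)"
      have "blinfun_apply (?a - y) \<tau> \<le> norm (?a - y) * norm \<tau>"
        using norm_blinfun[of "?a - y" \<tau>] by simp
      also have "\<dots> \<le> \<delta> * norm \<tau>"
        using memb by (intro mult_right_mono) (auto simp: A_def dist_norm norm_minus_commute less_imp_le)
      finally have "(1 / real N) * blinfun_apply (sum_list (map mu is)) \<tau> \<le> ?r"
        by (simp add: blinfun.diff_left blinfun.scaleR_left)
      then have "blinfun_apply (sum_list (map mu is)) \<tau> \<le> real N * ?r"
        using N by (simp add: field_simps)
      moreover have "length is = N" using memb by (simp add: A_def words_def)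
      ultimately show "prod_list (map p is) \<le> exp (real N * ?r) / Z ^ N"
        using Z by (simp add: prod_p divide_right_mono)
    qed
    also have "\<dots> = real (card A) / real CARD('n) ^ N * exp (real N * (?r - log_mgf mu \<tau>))"
      by (simp add: Z_eq power_mult_distrib exp_of_nat_mult[symmetric] right_diff_distrib exp_diff)
    also have "real (card A) / real CARD('n) ^ N = mean_prob mu N (ball y \<delta>)"
      by (simp add: mean_prob_def A_def)
    finally have "1 / 2 \<le> mean_prob mu N (ball y \<delta>) * exp (real N * (?r - log_mgf mu \<tau>))" .
    then have "1 / 2 * exp (- (real N * (?r - log_mgf mu \<tau>))) \<le> mean_prob mu N (ball y \<delta>)"
      by (simp only: exp_minus) (simp add: divide_simps mult.commute)
    then show "exp (- (real N * (blinfun_apply y \<tau> - log_mgf mu \<tau> + \<delta> * norm \<tau>))) / 2 \<le> mean_prob mu N (ball y \<delta>)"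
      by (simp add: algebra_simps)
  qed
qed

text \<open>Multiplicative constants disappear on the exponential scale.\<close>

lemma limsup_log_le:
  assumes k: "k > 0" and p: "\<And>N. N \<ge> N0 \<Longrightarrow> p N \<le> k * exp (- (real N * c))"
  shows "limsup (\<lambda>N. ereal (1 / real N) * log_ereal (p N)) \<le> ereal (- c)"
proof -
  have "limsup (\<lambda>N. ereal (1 / real N) * log_ereal (p N)) \<le> limsup (\<lambda>N. ereal (ln k / real N - c))"
  proof (rule Limsup_mono, rule eventually_sequentiallyI[of "max 1 N0"])
    fix N assume N: "max 1 N0 \<le> N"
    show "ereal (1 / real N) * log_ereal (p N) \<le> ereal (ln k / real N - c)"
    proof (cases "p N \<le> 0")
      case True
      then show ?thesis using N by (simp add: log_ereal_def)
    next
      case False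
      then have "ln (p N) \<le> ln (k * exp (- (real N * c)))" using p[of N] N by simp
      also have "\<dots> = ln k - real N * c" using k by (simp add: ln_mult)
      finally have "ln (p N) / real N \<le> (ln k - real N * c) / real N" by (simp add: divide_right_mono)
      then show ?thesis using False N by (simp add: log_ereal_def diff_divide_distrib)
    qed
  qed
  also have "\<dots> = ereal (- c)"
  proof (rule lim_imp_Limsup)
    have "(\<lambda>N. ln k / real N - c) \<longlonglongrightarrow> 0 - c" by (intro tendsto_intros lim_const_over_n)
    then show "(\<lambda>N. ereal (ln k / real N - c)) \<longlonglongrightarrow> ereal (- c)" by simp
  qed simp
  finally show ?thesis .
qed

lemma liminf_log_ge:
  assumes k: "k > 0" and p: "\<And>N. N \<ge> N0 \<Longrightarrow> k * exp (- (real N * c)) \<le> p N"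
  shows "ereal (- c) \<le> liminf (\<lambda>N. ereal (1 / real N) * log_ereal (p N))"
proof -
  have "ereal (- c) = liminf (\<lambda>N. ereal (ln k / real N - c))"
  proof (rule lim_imp_Liminf[symmetric])
    have "(\<lambda>N. ln k / real N - c) \<longlonglongrightarrow> 0 - c" by (intro tendsto_intros lim_const_over_n)
    then show "(\<lambda>N. ereal (ln k / real N - c)) \<longlonglongrightarrow> ereal (- c)" by simp
  qed simp
  also have "\<dots> \<le> liminf (\<lambda>N. ereal (1 / real N) * log_ereal (p N))"
  proof (rule Liminf_mono, rule eventually_sequentiallyI[of "max 1 N0"])
    fix N assume N: "max 1 N0 \<le> N"
    have pos: "0 < k * exp (- (real N * c))" using k by simp
    also have le: "\<dots> \<le> p N" using p[of N] N by simp
    finally have pN: "0 < p N" .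
    have "ln k - real N * c = ln (k * exp (- (real N * c)))" using k by (simp add: ln_mult)
    also have "\<dots> \<le> ln (p N)" using pos le pN by simp
    finally have "(ln k - real N * c) / real N \<le> ln (p N) / real N" by (simp add: divide_right_mono)
    then show "ereal (ln k / real N - c) \<le> ereal (1 / real N) * log_ereal (p N)"
      using pN N by (simp add: log_ereal_def diff_divide_distrib)
  qed
  finally show ?thesis .
qed

lemma mean_in_convex_hull:
  fixes mu :: "'n::finite \<Rightarrow> 't::euclidean_space \<Rightarrow>\<^sub>L real"
  assumes "N \<ge> 1" "is \<in> words N"
  shows "(1 / real N) *\<^sub>R sum_list (map mu is) \<in> convex hull (range mu)"
proof -
  have "(\<Sum>k\<in>{0..<N}. (1 / real N) *\<^sub>R mu (is ! k)) \<in> convex hull (range mu)"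
    using assms by (intro convex_sum) (auto intro: hull_inc)
  then show ?thesis
    using assms by (simp add: sum_list_sum_nth words_def scaleR_sum_right)
qed

text \<open>The single exponential of a largest \<open>mu i \<tau>\<close> already bounds the sum from below. It follows that
  the rate function is bounded on the hull, including its boundary.\<close>

lemma apply_le_log_mgf:
  fixes mu :: "'n::finite \<Rightarrow> 't::euclidean_space \<Rightarrow>\<^sub>L real"
  assumes "x \<in> convex hull (range mu)"
  shows "blinfun_apply x \<tau> - log_mgf mu \<tau> \<le> ln (real CARD('n))"
proof -
  define Z where "Z = (\<Sum>i\<in>UNIV. exp (blinfun_apply (mu i) \<tau>))"
  have Z: "Z > 0" unfolding Z_def by (intro sum_pos) auto
  have "blinfun_apply (mu i) \<tau> \<le> ln Z" for i
  proof -
    have "exp (blinfun_apply (mu i) \<tau>) \<le> Z" unfolding Z_def by (rule member_le_sum) auto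
    then show ?thesis using Z by (simp add: ln_ge_iff)
  qed
  moreover have "convex {x :: 't \<Rightarrow>\<^sub>L real. blinfun_apply x \<tau> \<le> ln Z}"
  proof -
    have "linear (\<lambda>x :: 't \<Rightarrow>\<^sub>L real. blinfun_apply x \<tau>)"
      by (rule linearI) (simp_all add: blinfun.add_left blinfun.scaleR_left)
    from convex_linear_vimage[OF this convex_real_interval(2)[of "ln Z"]]
    show ?thesis by (simp add: vimage_def)
  qed
  ultimately have "convex hull (range mu) \<subseteq> {x. blinfun_apply x \<tau> \<le> ln Z}"
    by (intro hull_minimal) auto
  moreover have "log_mgf mu \<tau> = ln Z - ln (real CARD('n))"
    using Z by (simp add: log_mgf_def Z_def[symmetric] ln_div)
  ultimately show ?thesis using assms by auto
qed

lemma log_mgf_0 [simp]: "log_mgf mu 0 = 0"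
  by (simp add: log_mgf_def)

lemma continuous_log_mgf:
  fixes mu :: "'n::finite \<Rightarrow> 't::euclidean_space \<Rightarrow>\<^sub>L real"
  shows "continuous_on S (log_mgf mu)"
proof -
  have "(\<Sum>i\<in>UNIV. exp (blinfun_apply (mu i) \<tau>)) / real CARD('n) \<noteq> 0" for \<tau>
    using sum_pos[of UNIV "\<lambda>i. exp (blinfun_apply (mu i) \<tau>)"] by auto
  then show ?thesis
    unfolding log_mgf_def by (intro continuous_on_ln continuous_on_divide continuous_intros ballI) auto
qed

text \<open>The gradient of the logarithmic moment generating function is the tilted mean.\<close>

lemma log_mgf_directional_derivative:
  fixes mu :: "'n::finite \<Rightarrow> 't::euclidean_space \<Rightarrow>\<^sub>L real" and \<tau> \<sigma> :: 't
  defines "y \<equiv> \<Sum>i\<in>UNIV. (exp (blinfun_apply (mu i) \<tau>) / (\<Sum>j\<in>UNIV. exp (blinfun_apply (mu j) \<tau>))) *\<^sub>R mu i"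
  shows "((\<lambda>s. log_mgf mu (\<tau> + s *\<^sub>R \<sigma>)) has_real_derivative blinfun_apply y \<sigma>) (at 0)"
proof -
  define Z where "Z = (\<Sum>i\<in>UNIV. exp (blinfun_apply (mu i) \<tau>))"
  have Z: "Z > 0" unfolding Z_def by (intro sum_pos) auto
  have "((\<lambda>s. ln ((\<Sum>i\<in>UNIV. exp (blinfun_apply (mu i) \<tau> + s * blinfun_apply (mu i) \<sigma>)) / real CARD('n)))
       has_real_derivative (\<Sum>i\<in>UNIV. exp (blinfun_apply (mu i) \<tau>) * blinfun_apply (mu i) \<sigma>) / Z) (at 0)"
    using Z by (auto intro!: derivative_eq_intros sum.cong simp: Z_def[symmetric])
  also have "(\<Sum>i\<in>UNIV. exp (blinfun_apply (mu i) \<tau>) * blinfun_apply (mu i) \<sigma>) / Z = blinfun_apply y \<sigma>"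
    by (simp add: y_def Z_def[symmetric] blinfun.sum_left blinfun.scaleR_left sum_divide_distrib)
  finally show ?thesis by (simp add: log_mgf_def blinfun.add_right blinfun.scaleR_right)
qed

text \<open>At a maximizer \<open>\<tau>\<close> of \<open>x(\<tau>) - \<Lambda>(\<tau>) - \<epsilon>|\<tau>|\<^sup>2/2\<close> the first order condition says that the tilted mean \<open>y\<close>
  is \<open>x - \<epsilon>\<tau>\<close>, in the identification of \<open>\<t>\<close> with its dual. Therefore \<open>y(\<tau>) \<le> x(\<tau>)\<close>. The maximum is at
  least the value \<open>0\<close> at the origin, whereas \<open>x(\<tau>) - \<Lambda>(\<tau>)\<close> is at most \<open>log n\<close> for \<open>n\<close> letters, so
  \<open>\<epsilon>|\<tau>|\<^sup>2 \<le> 2 log n\<close> and \<open>\<epsilon>|\<tau>|\<close> tends to \<open>0\<close> with \<open>\<epsilon>\<close>.\<close>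

lemma exists_tilted_mean_near:
  fixes mu :: "'n::finite \<Rightarrow> 't::euclidean_space \<Rightarrow>\<^sub>L real"
  assumes x: "x \<in> convex hull (range mu)" and \<eta>: "\<eta> > 0"
  obtains \<tau> y where
    "y = (\<Sum>i\<in>UNIV. (exp (blinfun_apply (mu i) \<tau>) / (\<Sum>j\<in>UNIV. exp (blinfun_apply (mu j) \<tau>))) *\<^sub>R mu i)"
    "dist x y < \<eta>" "blinfun_apply y \<tau> \<le> blinfun_apply x \<tau>"
proof -
  define d where "d = ln (real CARD('n))"
  have d: "d \<ge> 0" by (simp add: d_def Suc_le_eq)
  \<comment> \<open>any \<open>\<epsilon>\<close> with \<open>2\<epsilon>d < \<eta>\<^sup>2\<close> would do; the summand \<open>1\<close> covers \<open>d = 0\<close>\<close>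
  define \<epsilon> where "\<epsilon> = \<eta>\<^sup>2 / (2 * d + 1)"
  have \<epsilon>: "\<epsilon> > 0" "\<epsilon> * (2 * d) < \<eta>\<^sup>2"
    using d \<eta> by (auto simp: \<epsilon>_def field_simps)
  define \<phi> where "\<phi> \<tau> = blinfun_apply x \<tau> - log_mgf mu \<tau> - \<epsilon> / 2 * (\<tau> \<bullet> \<tau>)" for \<tau>
  have \<phi>_le: "\<phi> \<tau> \<le> d - \<epsilon> / 2 * (\<tau> \<bullet> \<tau>)" for \<tau>
    using apply_le_log_mgf[OF x, of \<tau>] by (simp add: \<phi>_def d_def)
  have \<phi>0: "\<phi> 0 = 0" by (simp add: \<phi>_def)
  \<comment> \<open>outside the ball of radius \<open>R\<close> the quadratic term makes \<open>\<phi>\<close> nonpositive\<close>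
  define R where "R = 1 + 2 * d / \<epsilon>"
  have R: "R \<ge> 1" using d \<epsilon> by (simp add: R_def)
  have "continuous_on (cball 0 R) \<phi>"
    unfolding \<phi>_def by (intro continuous_intros continuous_log_mgf)
  then have "\<exists>\<tau>\<in>cball 0 R. \<forall>\<sigma>\<in>cball 0 R. \<phi> \<sigma> \<le> \<phi> \<tau>"
    using R by (intro continuous_attains_sup) auto
  then obtain \<tau> where \<tau>: "\<And>\<sigma>. norm \<sigma> \<le> R \<Longrightarrow> \<phi> \<sigma> \<le> \<phi> \<tau>"
    by (auto simp: Ball_def)
  have max: "\<phi> \<sigma> \<le> \<phi> \<tau>" for \<sigma>
  proof (cases "norm \<sigma> \<le> R")
    case False
    have "R * 1 \<le> norm \<sigma> * norm \<sigma>" using False R by (intro mult_mono) auto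
    then have "2 * d / \<epsilon> \<le> \<sigma> \<bullet> \<sigma>" by (simp add: R_def dot_square_norm power2_eq_square)
    then have "d \<le> \<epsilon> / 2 * (\<sigma> \<bullet> \<sigma>)" using \<epsilon> by (simp add: field_simps)
    then have "\<phi> \<sigma> \<le> 0" using \<phi>_le[of \<sigma>] by linarith
    also have "\<dots> \<le> \<phi> \<tau>" using \<tau>[of 0] R \<phi>0 by simp
    finally show ?thesis .
  qed (rule \<tau>)
  define y where "y = (\<Sum>i\<in>UNIV. (exp (blinfun_apply (mu i) \<tau>) / (\<Sum>j\<in>UNIV. exp (blinfun_apply (mu j) \<tau>))) *\<^sub>R mu i)"
  have diff: "blinfun_apply (x - y) \<sigma> = \<epsilon> * (\<tau> \<bullet> \<sigma>)" for \<sigma>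
  proof -
    have "((\<lambda>s. \<phi> (\<tau> + s *\<^sub>R \<sigma>)) has_real_derivative
            (blinfun_apply x \<sigma> - blinfun_apply y \<sigma> - \<epsilon> * (\<tau> \<bullet> \<sigma>))) (at 0)"
      unfolding \<phi>_def blinfun.add_right blinfun.scaleR_right inner_add_left inner_add_right inner_scaleR_left inner_scaleR_right y_def
      by (auto intro!: derivative_eq_intros log_mgf_directional_derivative simp: inner_commute)
    from DERIV_local_max[OF this, of 1] max show ?thesis
      by (simp add: blinfun.diff_left)
  qed
  have "0 \<le> \<phi> \<tau>" using max[of 0] \<phi>0 by simp
  then have "\<epsilon> * (norm \<tau>)\<^sup>2 \<le> 2 * d" using \<phi>_le[of \<tau>] by (simp add: dot_square_norm)
  then have "\<epsilon> * (\<epsilon> * (norm \<tau>)\<^sup>2) \<le> \<epsilon> * (2 * d)" using \<epsilon> by (intro mult_left_mono) auto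
  then have "(\<epsilon> * norm \<tau>)\<^sup>2 < \<eta>\<^sup>2" using \<epsilon>(2) by (simp add: power2_eq_square mult_ac)
  then have "\<epsilon> * norm \<tau> < \<eta>" by (rule power2_less_imp_less) (use \<eta> in simp)
  moreover have "norm (x - y) \<le> \<epsilon> * norm \<tau>"
  proof (rule norm_blinfun_bound)
    fix \<sigma>
    have "\<bar>\<tau> \<bullet> \<sigma>\<bar> \<le> norm \<tau> * norm \<sigma>" by (rule Cauchy_Schwarz_ineq2)
    then show "norm (blinfun_apply (x - y) \<sigma>) \<le> \<epsilon> * norm \<tau> * norm \<sigma>"
      using \<epsilon> by (simp add: diff abs_mult)
  qed (use \<epsilon> in auto)
  ultimately have "dist x y < \<eta>" by (simp add: dist_norm)
  moreover have "blinfun_apply y \<tau> \<le> blinfun_apply x \<tau>"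
  proof -
    have "0 \<le> \<epsilon> * (\<tau> \<bullet> \<tau>)" using \<epsilon> by simp
    also have "\<dots> = blinfun_apply x \<tau> - blinfun_apply y \<tau>"
      using diff[of \<tau>] by (simp only: blinfun.diff_left)
    finally show ?thesis by simp
  qed
  ultimately show ?thesis by (rule that[OF y_def])
qed

text \<open>Cramer's theorem for the uniform distribution on a finite family of points in a dual space. It
  is stated for arbitrary measures that agree with the law of the mean on the Borel subsets of the
  hull, so that it can be applied to measures given in a different form.\<close>

theorem cramer_large_deviations:
  fixes mu :: "'n::finite \<Rightarrow> 't::euclidean_space \<Rightarrow>\<^sub>L real" and m :: "nat \<Rightarrow> ('t \<Rightarrow>\<^sub>L real) measure"
    and J :: "('t \<Rightarrow>\<^sub>L real) \<Rightarrow> ereal"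
  defines "E \<equiv> convex hull (range mu)"
  assumes m: "\<And>N. N \<ge> 1 \<Longrightarrow> prob_space (m N)" "\<And>N. N \<ge> 1 \<Longrightarrow> space (m N) = E"
      "\<And>N. N \<ge> 1 \<Longrightarrow> sets (m N) = sets (restrict_space borel E)"
    and meas: "\<And>N F. N \<ge> 1 \<Longrightarrow> F \<in> sets (restrict_space borel E) \<Longrightarrow> measure (m N) F = mean_prob mu N F"
    and J: "\<And>x. J x = (SUP \<tau>. ereal (blinfun_apply x \<tau> - log_mgf mu \<tau>))"
  shows "large_deviation_principle E m J"
proof -
  have compE: "compact E"
    unfolding E_def by (intro finite_imp_compact_convex_hull) auto
  then have closedE: "closed E" by (rule compact_imp_closed)
  have J0: "0 \<le> J x" for x
    unfolding J by (rule SUP_upper2[of 0]) auto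
  have Jlevel: "closed {x. J x \<le> c}" for c
  proof -
    have "{x. J x \<le> c} = (\<Inter>\<tau>. {x. ereal (blinfun_apply x \<tau> - log_mgf mu \<tau>) \<le> c})"
      by (auto simp: J SUP_le_iff)
    moreover have "closed {x. ereal (blinfun_apply x \<tau> - log_mgf mu \<tau>) \<le> c}" for \<tau>
      by (intro closed_Collect_le continuous_intros)
    ultimately show ?thesis by auto
  qed
  have upper: "limsup (\<lambda>N. ereal (1 / real N) * log_ereal (measure (m N) F)) \<le> - (INF x\<in>F. J x)"
    if F: "closedin (top_of_set E) F" for F
  proof (rule ccontr)
    let ?l = "limsup (\<lambda>N. ereal (1 / real N) * log_ereal (measure (m N) F))"
    assume "\<not> ?l \<le> - (INF x\<in>F. J x)"
    then have "- ?l < (INF x\<in>F. J x)" by (simp add: ereal_uminus_less_reorder not_le)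
    then obtain c where c: "- ?l < ereal c" "ereal c < (INF x\<in>F. J x)"
      using ereal_dense2 by blast
    have "closed F" and FE: "F \<subseteq> E"
      using F closedE closedin_closed_trans closedin_imp_subset by blast+
    then have compF: "compact F" using compE compact_Int_closed[of E F] by (simp add: Int_absorb1)
    have "\<exists>\<tau>. c < blinfun_apply x \<tau> - log_mgf mu \<tau>" if "x \<in> F" for x
    proof -
      have "ereal c < J x" using c(2) that by (meson INF_lower less_le_trans)
      then show ?thesis by (auto simp: J less_SUP_iff)
    qed
    then obtain t where t: "\<And>x. x \<in> F \<Longrightarrow> c < blinfun_apply x (t x) - log_mgf mu (t x)" by metis
    define B where "B x = {y. c < blinfun_apply y (t x) - log_mgf mu (t x)}" for x
    have "open (B x)" for x
      unfolding B_def by (intro open_Collect_less continuous_intros)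
    moreover have "F \<subseteq> (\<Union>x\<in>F. B x)" using t by (auto simp: B_def)
    ultimately obtain K where K: "K \<subseteq> F" "finite K" "F \<subseteq> (\<Union>x\<in>K. B x)"
      using compactE_image[OF compF, of F B] by metis
    have "?l \<le> ereal (- c)"
    proof (rule limsup_log_le[of "real (card K) + 1" 1])
      fix N :: nat assume N: "N \<ge> 1"
      have "F \<in> sets (restrict_space borel E)"
        using \<open>closed F\<close> FE by (auto simp: sets_restrict_space image_iff intro!: bexI[of _ F])
      then have "measure (m N) F = mean_prob mu N F" using N by (rule meas[rotated])
      also have "\<dots> \<le> mean_prob mu N (\<Union>x\<in>K. B x)" by (rule mean_prob_mono[OF K(3)])
      also have "\<dots> \<le> (\<Sum>x\<in>K. mean_prob mu N (B x))" by (rule mean_prob_UN_le[OF K(2)])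
      also have "\<dots> \<le> (\<Sum>x\<in>K. exp (- (real N * c)))"
        unfolding B_def by (intro sum_mono chernoff_bound N)
      also have "\<dots> \<le> (real (card K) + 1) * exp (- (real N * c))" by (simp add: algebra_simps)
      finally show "measure (m N) F \<le> (real (card K) + 1) * exp (- (real N * c))" .
    qed simp
    then show False using c(1) by (simp add: ereal_uminus_less_reorder leD)
  qed
  have lower: "- (INF x\<in>U. J x) \<le> liminf (\<lambda>N. ereal (1 / real N) * log_ereal (measure (m N) U))"
    if U: "openin (top_of_set E) U" for U
  proof -
    let ?l = "liminf (\<lambda>N. ereal (1 / real N) * log_ereal (measure (m N) U))"
    obtain V where V: "open V" "U = E \<inter> V" using U by (auto simp: openin_open)
    have "- ?l \<le> J x" if x: "x \<in> U" for x
    proof (cases "J x")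
      case (real j)
      have "ereal (- (j + r)) \<le> ?l" if r: "r > 0" for r
      proof -
        obtain \<eta> where \<eta>: "\<eta> > 0" "ball x (2 * \<eta>) \<subseteq> V"
        proof -
          obtain e where "e > 0" "ball x e \<subseteq> V" using V x by (auto simp: open_contains_ball)
          then show thesis by (intro that[of "e / 2"]) auto
        qed
        have "x \<in> convex hull (range mu)" using x V by (simp add: E_def)
        from exists_tilted_mean_near[OF this \<eta>(1)] obtain \<tau> y where
          y: "y = (\<Sum>i\<in>UNIV. (exp (blinfun_apply (mu i) \<tau>) / (\<Sum>j\<in>UNIV. exp (blinfun_apply (mu j) \<tau>))) *\<^sub>R mu i)"
            "dist x y < \<eta>" "blinfun_apply y \<tau> \<le> blinfun_apply x \<tau>" by blast
        \<comment> \<open>small enough to stay in \<open>V\<close> and to make the oscillation of \<open>\<tau>\<close> on the ball at most \<open>r\<close>\<close>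
        define \<delta> where "\<delta> = min \<eta> (r / (norm \<tau> + 1))"
        have \<delta>: "\<delta> > 0" "\<delta> \<le> \<eta>" using \<eta> r by (auto simp: \<delta>_def add_nonneg_pos)
        have \<delta>r: "\<delta> * norm \<tau> \<le> r"
        proof -
          have "\<delta> * norm \<tau> \<le> r / (norm \<tau> + 1) * (norm \<tau> + 1)"
            using r by (intro mult_mono) (auto simp: \<delta>_def)
          also have "\<dots> = r" using norm_ge_zero[of \<tau>] by (simp add: add_nonneg_eq_0_iff)
          finally show ?thesis .
        qed
        obtain N0 where N0: "\<And>N. N \<ge> N0 \<Longrightarrow>
          exp (- (real N * (blinfun_apply y \<tau> - log_mgf mu \<tau> + \<delta> * norm \<tau>))) / 2 \<le> mean_prob mu N (ball y \<delta>)"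
          using tilted_lower_bound[OF \<delta>(1), of mu \<tau>] unfolding y(1) by blast
        have "ereal (blinfun_apply x \<tau> - log_mgf mu \<tau>) \<le> J x" unfolding J by (rule SUP_upper) simp
        then have rate: "blinfun_apply y \<tau> - log_mgf mu \<tau> + \<delta> * norm \<tau> \<le> j + r"
          using real y(3) \<delta>r by simp
        have ball: "ball y \<delta> \<subseteq> V"
        proof
          fix z assume "z \<in> ball y \<delta>"
          then have "dist x z < 2 * \<eta>" using y(2) \<delta>(2) dist_triangle[of x z y] by simp
          then show "z \<in> V" using \<eta>(2) by auto
        qed
        show ?thesis
        proof (rule liminf_log_ge[of "1 / 2" "max 1 N0"])
          fix N assume N: "max 1 N0 \<le> N"
          have "1 / 2 * exp (- (real N * (j + r)))
              \<le> exp (- (real N * (blinfun_apply y \<tau> - log_mgf mu \<tau> + \<delta> * norm \<tau>))) / 2"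
            using mult_left_mono[OF rate, of "real N"] by simp
          also have "\<dots> \<le> mean_prob mu N (ball y \<delta>)" using N0 N by simp
          also have "\<dots> \<le> mean_prob mu N V" by (rule mean_prob_mono[OF ball])
          also have "\<dots> = mean_prob mu N U"
            using mean_in_convex_hull[of N _ mu] N unfolding mean_prob_def V(2) E_def
            by (intro arg_cong2[where f = "(/)"] arg_cong[where f = real] arg_cong[where f = card]) auto
          also have "\<dots> = measure (m N) U"
            using V N by (intro meas[symmetric]) (auto simp: sets_restrict_space)
          finally show "1 / 2 * exp (- (real N * (j + r))) \<le> measure (m N) U" .
        qed simp
      qed
      then have "- ?l \<le> ereal (j + r)" if "r > 0" for r
        using that by (metis ereal_uminus_le_reorder uminus_ereal.simps(1))
      then have "- ?l \<le> ereal j + ereal r" if "r > 0" for r using that by simp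
      then show ?thesis unfolding real by (rule ereal_le_epsilon2)
    qed (use J0[of x] in auto)
    then have "- ?l \<le> (INF x\<in>U. J x)" by (rule INF_greatest)
    then show ?thesis by (simp add: ereal_uminus_le_reorder)
  qed
  have "closedin (top_of_set E) {x\<in>E. J x \<le> c}" for c
  proof -
    have "{x\<in>E. J x \<le> c} = E \<inter> {x. J x \<le> c}" by auto
    then show ?thesis using Jlevel by (auto intro: closedin_closed_Int)
  qed
  moreover have "compact {x\<in>E. 0 \<le> J x \<and> J x \<le> ereal c}" for c
  proof -
    have "{x\<in>E. 0 \<le> J x \<and> J x \<le> ereal c} = E \<inter> {x. J x \<le> ereal c}" using J0 by auto
    then show ?thesis using Jlevel compE by (auto intro: compact_Int_closed)
  qed
  ultimately show ?thesis
    unfolding large_deviation_principle_def using closedE m J0 upper lower by blast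
qed

section \<open>Diagonalization of bounded commuting matrices\<close>

lemma norm_vector_smult: "norm (c *s v) = cmod c * norm (v :: complex^'n)"
  by (simp add: norm_vec_def norm_mult L2_set_right_distrib)

text \<open>The vector \<open>p(A)v\<close>, by Horner's scheme.\<close>

definition poly_act :: "complex^'n^'n \<Rightarrow> complex poly \<Rightarrow> complex^'n \<Rightarrow> complex^'n" where
  "poly_act A p v = fold_coeffs (\<lambda>a u. a *s v + A *v u) p 0"

lemma poly_act_0 [simp]: "poly_act A 0 v = 0"
  by (simp add: poly_act_def)

lemma poly_act_pCons [simp]: "poly_act A (pCons a p) v = a *s v + A *v poly_act A p v"
  by (cases "p = 0 \<and> a = 0") (auto simp: poly_act_def)

lemma poly_act_add: "poly_act A (p + q) v = poly_act A p v + poly_act A q v"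
  by (induction p q rule: poly_induct2)
    (simp_all add: vec.scale_left_distrib matrix_vector_right_distrib)

lemma poly_act_smult: "poly_act A (smult c p) v = c *s poly_act A p v"
  by (induction p) (simp_all add: vec.scale_right_distrib vector_scalar_commute)

text \<open>A root of an annihilating polynomial of \<open>v\<close> can be split off by passing from \<open>v\<close> to \<open>(A - c)v\<close>.\<close>

lemma poly_act_mult_linear:
  "poly_act A ([:- c, 1:] * q) v = poly_act A q (A *v v - c *s v)"
proof -
  have "poly_act A q (A *v v - c *s v) = A *v poly_act A q v - c *s poly_act A q v"
    by (induction q) (simp_all add: matrix_vector_right_distrib matrix_vector_mult_diff_distrib
        vector_scalar_commute vec.scale_right_distrib vec.scale_right_diff_distrib mult.commute)
  moreover have "[:- c, 1:] * q = pCons 0 q + smult (- c) q" by simp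
  ultimately show ?thesis by (simp only: poly_act_add poly_act_smult poly_act_pCons) simp
qed

text \<open>The vectors \<open>v, Av, A\<^sup>2v, \<dots>\<close> cannot all be independent; the first one that depends on its
  predecessors gives a monic polynomial.\<close>

lemma exists_annihilating_poly:
  fixes A :: "complex^'n^'n"
  shows "\<exists>p. p \<noteq> 0 \<and> poly_act A p v = 0"
proof -
  define a where "a i = poly_act A (monom 1 i) v" for i
  have "\<exists>k. a k \<in> vec.span (a ` {..<k})"
  proof (rule ccontr)
    assume "\<nexists>k. a k \<in> vec.span (a ` {..<k})"
    then have new: "a k \<notin> vec.span (a ` {..<k})" for k by blast
    \<comment> \<open>otherwise there would be more independent vectors than the dimension\<close>
    have "vec.independent (a ` {..<k}) \<and> card (a ` {..<k}) = k" for k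
    proof (induction k)
      case (Suc k)
      have "a k \<notin> a ` {..<k}" using new[of k] vec.span_base[of "a k" "a ` {..<k}"] by (rule contrapos_nn)
      then show ?case
        using Suc new[of k] by (simp add: lessThan_Suc vec.independent_insertI)
    qed (simp add: vec.independent_empty)
    then have "Suc CARD('n) \<le> vec.dim (UNIV :: (complex^'n) set)"
      using vec.independent_card_le_dim[of "a ` {..<Suc CARD('n)}" UNIV] by simp
    then show False by (simp add: vec_dim_card del: vec.dim_UNIV)
  qed
  then obtain k where k: "a k \<in> vec.span (a ` {..<k})" by blast
  define V where "V = {poly_act A q v | q. \<forall>i\<ge>k. coeff q i = 0}"
  have "vec.subspace V"
  proof (rule vec.subspaceI)
    show "0 \<in> V" unfolding V_def by (intro CollectI exI[of _ 0]) simp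
  next
    fix x y assume "x \<in> V" "y \<in> V"
    then obtain q r where "x = poly_act A q v" "\<forall>i\<ge>k. coeff q i = 0"
      "y = poly_act A r v" "\<forall>i\<ge>k. coeff r i = 0" by (auto simp: V_def)
    then show "x + y \<in> V"
      unfolding V_def by (intro CollectI exI[of _ "q + r"]) (simp add: poly_act_add)
  next
    fix c x assume "x \<in> V"
    then obtain q where "x = poly_act A q v" "\<forall>i\<ge>k. coeff q i = 0" by (auto simp: V_def)
    then show "c *s x \<in> V"
      unfolding V_def by (intro CollectI exI[of _ "smult c q"]) (simp add: poly_act_smult)
  qed
  moreover have "a ` {..<k} \<subseteq> V"
    unfolding V_def a_def by (auto intro!: exI[of _ "monom 1 _"])
  ultimately have "a k \<in> V" using k vec.span_minimal by blast
  then obtain q where q: "a k = poly_act A q v" "\<forall>i\<ge>k. coeff q i = 0" by (auto simp: V_def)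
  have "poly_act A (monom 1 k + smult (- 1) q) v = 0"
    using q by (simp add: poly_act_add poly_act_smult a_def[symmetric] del: smult_minus_left)
  moreover have "coeff (monom 1 k + smult (- 1) q) k = 1" using q by simp
  then have "monom 1 k + smult (- 1) q \<noteq> 0" by force
  ultimately show ?thesis by blast
qed

text \<open>The second bound is the first one for the powers of the inverse of \<open>A\<close>, expressed without the inverse.\<close>

definition power_bounded :: "complex^'n^'n \<Rightarrow> bool" where
  "power_bounded A \<longleftrightarrow>
     (\<exists>K. \<forall>k v. norm (((*v) A ^^ k) v) \<le> K * norm v \<and> norm v \<le> K * norm (((*v) A ^^ k) v))"

text \<open>On a Jordan block \<open>A\<^sup>k y = c\<^sup>k y + k c\<^bsup>k-1\<^esup> z\<close>. Power boundedness keeps \<open>|c|\<^sup>k\<close> away from \<open>0\<close> and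
  infinity if \<open>z \<noteq> 0\<close>, so the second term would grow linearly in \<open>k\<close>.\<close>

lemma power_bounded_no_jordan_block:
  assumes A: "power_bounded A" and z: "A *v z = c *s z" and y: "A *v y = c *s y + z"
  shows "z = 0"
proof (rule ccontr)
  assume z0: "z \<noteq> 0"
  obtain K where K: "\<And>k v. norm (((*v) A ^^ k) v) \<le> K * norm v" "\<And>k v. norm v \<le> K * norm (((*v) A ^^ k) v)"
    using A unfolding power_bounded_def by blast
  have Az: "((*v) A ^^ k) z = c ^ k *s z" for k
    by (induction k) (simp_all add: z vector_scalar_commute mult.commute)
  have Ay: "((*v) A ^^ Suc k) y = c ^ Suc k *s y + of_nat (Suc k) *s (c ^ k *s z)" for k
  proof (induction k)
    case (Suc k)
    have "((*v) A ^^ Suc (Suc k)) y = A *v (c ^ Suc k *s y + of_nat (Suc k) *s (c ^ k *s z))"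
      by (subst funpow.simps) (simp only: o_apply Suc)
    also have "\<dots> = c ^ Suc k *s (c *s y + z) + of_nat (Suc k) *s (c ^ k *s (c *s z))"
      by (simp only: matrix_vector_right_distrib vector_scalar_commute y z)
    also have "\<dots> = c ^ Suc (Suc k) *s y + of_nat (Suc (Suc k)) *s (c ^ Suc k *s z)"
      by (simp add: vec_eq_iff algebra_simps)
    finally show ?case .
  qed (simp add: y)
  have up: "cmod c ^ k \<le> K" and low: "1 \<le> K * cmod c ^ k" for k
    using K(1)[of k z] K(2)[of z k] z0 by (simp_all add: Az norm_vector_smult norm_power)
  have K1: "K \<ge> 1" using up[of 0] by simp
  have bound: "real (Suc k) * norm z \<le> 2 * K * K * norm y" for k
  proof -
    have "real (Suc k) * (cmod c ^ k * norm z) = norm (((*v) A ^^ Suc k) y - c ^ Suc k *s y)"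
      unfolding Ay by (simp add: norm_vector_smult norm_mult norm_power del: of_nat_Suc power_Suc)
    also have "\<dots> \<le> norm (((*v) A ^^ Suc k) y) + norm (c ^ Suc k *s y)" by (rule norm_triangle_ineq4)
    also have "\<dots> \<le> K * norm y + K * norm y"
      using K(1)[of "Suc k" y] mult_right_mono[OF up[of "Suc k"], of "norm y"]
      by (simp add: norm_vector_smult norm_power norm_mult)
    finally have "K * (real (Suc k) * (cmod c ^ k * norm z)) \<le> K * (2 * K * norm y)"
      using K1 by (intro mult_left_mono) auto
    moreover have "real (Suc k) * norm z * 1 \<le> real (Suc k) * norm z * (K * cmod c ^ k)"
      by (intro mult_left_mono low) auto
    ultimately show ?thesis by (simp add: mult_ac)
  qed
  obtain k where "real k > 2 * K * K * norm y / norm z" using reals_Archimedean2 by blast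
  then have "real (Suc k) * norm z > 2 * K * K * norm y"
    using z0 by (simp add: field_simps) (smt (verit) norm_ge_zero)
  then show False using bound[of k] by simp
qed

text \<open>Induction on the degree of an annihilating polynomial of \<open>v\<close>: if \<open>c\<close> is a root, then \<open>(A - c)v\<close> is a
  sum of eigenvectors by induction. Those with eigenvalues other than \<open>c\<close> lie in the image of
  \<open>A - c\<close> on their own span; subtracting preimages from \<open>v\<close> leaves a generalized eigenvector for \<open>c\<close>,
  which is an eigenvector, because there are no Jordan blocks.\<close>

lemma power_bounded_span_eigenvectors:
  fixes A :: "complex^'n^'n"
  assumes A: "power_bounded A" and S: "vec.subspace S" "\<And>v. v \<in> S \<Longrightarrow> A *v v \<in> S"
    and v: "v \<in> S"
  shows "v \<in> vec.span {u\<in>S. \<exists>c. A *v u = c *s u}"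
proof -
  let ?Eig = "{u\<in>S. \<exists>c. A *v u = c *s u}"
  have EigS: "vec.span ?Eig \<subseteq> S" using S(1) by (intro vec.span_minimal) auto
  have main: "v \<in> vec.span ?Eig" if "p \<noteq> 0" "poly_act A p v = 0" "v \<in> S" for p v
    using that
  proof (induction "degree p" arbitrary: p v)
    case 0
    then obtain a where "p = [:a:]" "a \<noteq> 0" by (metis degree_eq_zeroE pCons_0_0)
    then have "v = 0" using 0 by simp
    then show ?case by (simp add: vec.span_zero)
  next
    case (Suc n)
    obtain c where "poly p c = 0"
      using fundamental_theorem_of_algebra_alt[of p] Suc.hyps(2) by fastforce
    then obtain q where pq: "p = [:- c, 1:] * q" by (metis dvdE poly_eq_0_iff_dvd)
    have q: "q \<noteq> 0" using Suc.prems(1) pq by auto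
    have "degree p = Suc (degree q)" using q unfolding pq by (subst degree_mult_eq) auto
    then have "n = degree q" using Suc.hyps(2) by simp
    moreover have "poly_act A q (A *v v - c *s v) = 0"
      using Suc.prems(2) by (simp only: pq poly_act_mult_linear)
    moreover have "A *v v - c *s v \<in> S"
      using S Suc.prems(3) by (intro vec.subspace_diff vec.subspace_scale) auto
    ultimately have "A *v v - c *s v \<in> vec.span ?Eig" using Suc.hyps(1) q by blast
    \<comment> \<open>split off the part of \<open>(A - c)v\<close> that lies in the image of \<open>A - c\<close> on the eigenvectors\<close>
    then have "\<exists>z w. A *v v - c *s v = z + (A *v w - c *s w) \<and> A *v z = c *s z \<and> w \<in> vec.span ?Eig"
    proof (induction rule: vec.span_induct_alt)
      case base
      show ?case by (intro exI[of _ 0]) (simp add: vec.span_zero)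
    next
      case (step a x y)
      then obtain b z w where b: "A *v x = b *s x" "x \<in> S" and zw: "y = z + (A *v w - c *s w)"
        "A *v z = c *s z" "w \<in> vec.span ?Eig" by auto
      show ?case
      proof (cases "b = c")
        case True
        have "A *v (a *s x + z) = c *s (a *s x + z)"
          using b zw True by (simp add: matrix_vector_right_distrib vector_scalar_commute
              vec.scale_right_distrib mult.commute)
        then show ?thesis using zw
          by (intro exI[of _ "a *s x + z"] exI[of _ w]) (simp add: add.assoc)
      next
        case False
        define r where "r = a / (b - c)"
        let ?w = "r *s x + w"
        have "A *v (r *s x) - c *s (r *s x) = ((b - c) * r) *s x"
          unfolding vector_scalar_commute b by (simp add: vec_eq_iff algebra_simps)
        also have "\<dots> = a *s x" using False by (simp add: r_def)
        finally have "a *s x + y = z + (A *v ?w - c *s ?w)"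
          unfolding zw(1) by (simp add: matrix_vector_right_distrib vec.scale_right_distrib algebra_simps)
        moreover have "?w \<in> vec.span ?Eig"
          using b by (intro vec.span_add[OF vec.span_scale[OF vec.span_base] zw(3)]) auto
        ultimately show ?thesis using zw(2) by blast
      qed
    qed
    then obtain z w where zw: "A *v v - c *s v = z + (A *v w - c *s w)" "A *v z = c *s z"
        "w \<in> vec.span ?Eig" by blast
    have y: "A *v (v - w) = c *s (v - w) + z"
      using zw(1) by (simp add: matrix_vector_mult_diff_distrib vec.scale_right_diff_distrib algebra_simps)
    have "z = 0" using power_bounded_no_jordan_block[OF A zw(2) y] .
    then have "v - w \<in> ?Eig"
      using y zw(3) EigS Suc.prems(3) S(1) by (auto intro: vec.subspace_diff)
    then have "(v - w) + w \<in> vec.span ?Eig" by (rule vec.span_add[OF vec.span_base zw(3)])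
    then show ?case by simp
  qed
  show ?thesis using exists_annihilating_poly[of A v] main v by blast
qed

text \<open>Induction on the dimension: an operator that is not scalar on \<open>S\<close> has proper eigenspaces in \<open>S\<close>, these
  span \<open>S\<close>, and each of them is invariant under the commuting family.\<close>

lemma commuting_power_bounded_span_eigenvectors:
  fixes F :: "(complex^'n^'n) set"
  assumes pb: "\<And>A. A \<in> F \<Longrightarrow> power_bounded A" and comm: "\<And>A B. A \<in> F \<Longrightarrow> B \<in> F \<Longrightarrow> A ** B = B ** A"
    and S: "vec.subspace S" "\<And>A v. A \<in> F \<Longrightarrow> v \<in> S \<Longrightarrow> A *v v \<in> S"
  shows "S \<subseteq> vec.span {u. \<forall>A\<in>F. \<exists>c. A *v u = c *s u}"
  using S
proof (induction "vec.dim S" arbitrary: S rule: less_induct)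
  case less
  let ?CE = "{u. \<forall>A\<in>F. \<exists>c. A *v u = c *s u}"
  show ?case
  proof (cases "\<forall>A\<in>F. \<exists>c. \<forall>u\<in>S. A *v u = c *s u")
    case True
    then have "S \<subseteq> ?CE" by blast
    then show ?thesis using vec.span_superset[of ?CE] by blast
  next
    case False
    then obtain A where A: "A \<in> F" and nonscalar: "\<And>c. \<exists>u\<in>S. A *v u \<noteq> c *s u" by blast
    have "{u\<in>S. \<exists>c. A *v u = c *s u} \<subseteq> vec.span ?CE"
    proof clarify
      fix u c assume u: "u \<in> S" "A *v u = c *s u"
      let ?S = "{s\<in>S. A *v s = c *s s}"
      have sub: "vec.subspace ?S"
      proof (rule vec.subspaceI)
        show "0 \<in> ?S" using vec.subspace_0[OF less.prems(1)] by simp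
        show "x + y \<in> ?S" if "x \<in> ?S" "y \<in> ?S" for x y
          using that vec.subspace_add[OF less.prems(1)]
          by (simp add: matrix_vector_right_distrib vec.scale_right_distrib)
        show "a *s x \<in> ?S" if "x \<in> ?S" for a x
          using that vec.subspace_scale[OF less.prems(1)]
          by (simp add: vector_scalar_commute mult.commute)
      qed
      have span: "vec.span ?S = ?S" "vec.span S = S"
        using sub less.prems(1) by (simp_all only: vec.span_eq_iff)
      obtain s where s: "s \<in> S" "A *v s \<noteq> c *s s" using nonscalar[of c] by blast
      then have "?S \<subset> S" by blast
      then have "vec.span ?S \<subset> vec.span S" by (simp only: span)
      then have "vec.dim ?S < vec.dim S" by (rule vec.dim_psubset)
      moreover have "B *v s \<in> ?S" if "B \<in> F" "s \<in> ?S" for B s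
      proof -
        have "A *v (B *v s) = B *v (A *v s)"
          using comm[OF A that(1)] by (simp add: matrix_vector_mul_assoc)
        also have "\<dots> = c *s (B *v s)" using that(2) by (simp add: vector_scalar_commute)
        finally show ?thesis using that less.prems(2) by auto
      qed
      ultimately have "?S \<subseteq> vec.span ?CE" using less.hyps sub by blast
      then show "u \<in> vec.span ?CE" using u by blast
    qed
    then have "vec.span {u\<in>S. \<exists>c. A *v u = c *s u} \<subseteq> vec.span ?CE"
      by (intro vec.span_minimal) auto
    then show ?thesis
      using power_bounded_span_eigenvectors[OF pb[OF A] less.prems(1) less.prems(2)[OF A]] by blast
  qed
qed

section \<open>Characters and diagonalization of bounded representations\<close>

text \<open>Additivity gives homogeneity over the rationals, and continuity extends it to the reals.\<close>

lemma continuous_additive_imp_linear: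
  fixes f :: "'a::real_normed_vector \<Rightarrow> real"
  assumes cont: "continuous_on UNIV f" and add: "\<And>x y. f (x + y) = f x + f y"
  shows "linear f"
proof (rule linearI)
  fix r :: real and x
  have f0: "f 0 = 0" using add[of 0 0] by simp
  have nat: "f (real n *\<^sub>R y) = real n * f y" for n y
    by (induction n) (simp_all add: f0 scaleR_left_distrib add algebra_simps)
  have neg: "f (- y) = - f y" for y using add[of y "- y"] f0 by simp
  have int: "f (of_int k *\<^sub>R y) = of_int k * f y" for k y
    by (cases k) (simp_all add: nat neg del: of_nat_Suc)
  have "\<rat> \<subseteq> {r. f (r *\<^sub>R x) = r * f x}"
  proof clarify
    fix q :: real assume "q \<in> \<rat>"
    then obtain a b :: int where q: "b > 0" "q = of_int a / of_int b" by (auto elim!: Rats_cases')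
    then have bq: "of_int b * q = of_int a" by simp
    have "of_int b * f (q *\<^sub>R x) = f ((of_int b * q) *\<^sub>R x)" by (simp only: int[symmetric] scaleR_scaleR)
    also have "\<dots> = of_int b * (q * f x)" by (simp only: bq int) (simp add: bq[symmetric])
    finally show "f (q *\<^sub>R x) = q * f x" using q(1) by simp
  qed
  moreover have "closed {r. f (r *\<^sub>R x) = r * f x}"
    by (intro closed_Collect_eq continuous_intros continuous_on_compose2[OF cont]) auto
  ultimately have "closure \<rat> \<subseteq> {r. f (r *\<^sub>R x) = r * f x}" by (rule closure_minimal)
  then show "f (r *\<^sub>R x) = r *\<^sub>R f x" by (auto simp: Rats_closure_real)
qed (rule add)

text \<open>A bounded character has modulus \<open>1\<close>. Its continuous logarithm, normalized at the origin, is additive,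
  because its additivity defect is a continuous function with values in a discrete set.\<close>

lemma bounded_continuous_character:
  fixes chi :: "'t::euclidean_space \<Rightarrow> complex"
  assumes cont: "continuous_on UNIV chi" and mult: "\<And>\<sigma> \<tau>. chi (\<sigma> + \<tau>) = chi \<sigma> * chi \<tau>"
    and one: "chi 0 = 1" and bdd: "\<And>\<tau>. norm (chi \<tau>) \<le> K"
  shows "\<exists>\<nu> :: 't \<Rightarrow>\<^sub>L real. \<forall>\<tau>. chi \<tau> = cis (2 * pi * blinfun_apply \<nu> \<tau>)"
proof -
  have inv: "chi \<tau> * chi (- \<tau>) = 1" for \<tau> using mult[of \<tau> "- \<tau>"] one by simp
  then have nz: "chi \<tau> \<noteq> 0" for \<tau> by (metis mult_zero_left zero_neq_one)
  have le1: "norm (chi \<tau>) \<le> 1" for \<tau>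
  proof (rule ccontr)
    assume *: "\<not> norm (chi \<tau>) \<le> 1"
    have "chi (real n *\<^sub>R \<tau>) = chi \<tau> ^ n" for n
      by (induction n) (simp_all add: one mult scaleR_left_distrib)
    then have "norm (chi \<tau>) ^ n \<le> K" for n by (metis bdd norm_power)
    moreover obtain n where "K < norm (chi \<tau>) ^ n" using real_arch_pow[of "norm (chi \<tau>)" K] * by auto
    ultimately show False by (meson not_le)
  qed
  have norm1: "norm (chi \<tau>) = 1" for \<tau>
  proof -
    have "1 = norm (chi \<tau>) * norm (chi (- \<tau>))" using inv[of \<tau>] by (metis norm_mult norm_one)
    also have "\<dots> \<le> norm (chi \<tau>) * 1" using le1 by (intro mult_left_mono) auto
    finally show ?thesis using le1[of \<tau>] by simp
  qed
  obtain g where g: "continuous_on UNIV g" "\<And>\<tau>. chi \<tau> = exp (g \<tau>)"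
    using continuous_logarithm_on_contractible[OF cont contractible_UNIV] nz by auto
  have Re0: "Re (g \<tau>) = 0" for \<tau> using norm1[of \<tau>] by (simp add: g(2))
  define h where "h \<tau> = Im (g \<tau>) - Im (g 0)" for \<tau>
  have chi_h: "chi \<tau> = cis (h \<tau>)" for \<tau>
  proof -
    have "chi \<tau> = chi \<tau> / chi 0" using one by simp
    also have "\<dots> = cis (h \<tau>)"
      using Re0 by (simp add: g(2) h_def exp_eq_polar cis_divide)
    finally show ?thesis .
  qed
  have conth: "continuous_on UNIV h" unfolding h_def by (intro continuous_intros g)
  have add: "h (\<sigma> + \<tau>) = h \<sigma> + h \<tau>" for \<sigma> \<tau>
  proof -
    \<comment> \<open>the additivity defect in units of \<open>2\<pi>\<close>, an integer\<close>
    let ?D = "\<lambda>\<tau>. (h (\<sigma> + \<tau>) - h \<sigma> - h \<tau>) / (2 * pi)"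
    have int: "?D \<tau> \<in> \<int>" for \<tau>
    proof -
      have "cis (h (\<sigma> + \<tau>)) = cis (h \<sigma> + h \<tau>)" using mult[of \<sigma> \<tau>] by (simp add: chi_h cis_mult)
      then have "cis (h (\<sigma> + \<tau>) - (h \<sigma> + h \<tau>)) = 1" by (simp add: cis_divide[symmetric])
      then obtain k :: int where "h (\<sigma> + \<tau>) - (h \<sigma> + h \<tau>) = 2 * pi * of_int k"
        by (auto simp: cis.ctr complex_eq_iff cos_one_2pi_int)
      then have "?D \<tau> = of_int k" by (simp add: diff_diff_eq)
      then show ?thesis by simp
    qed
    have "?D constant_on UNIV"
    proof (rule continuous_discrete_range_constant)
      show "continuous_on UNIV ?D"
        by (intro continuous_intros continuous_on_compose2[OF conth]) auto
      fix x :: 't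
      have "1 \<le> norm (?D y - ?D x)" if "?D y \<noteq> ?D x" for y
      proof -
        have "?D y - ?D x \<in> \<int>" using int by (intro Ints_diff)
        moreover have "?D y - ?D x \<noteq> 0" using that by simp
        ultimately show ?thesis unfolding real_norm_def by (rule Ints_nonzero_abs_ge1)
      qed
      then show "\<exists>e>0. \<forall>y. y \<in> UNIV \<and> ?D y \<noteq> ?D x \<longrightarrow> e \<le> norm (?D y - ?D x)"
        by (intro exI[of _ 1]) auto
    qed (rule convex_connected[OF convex_UNIV])
    then obtain a where "\<And>\<tau>. ?D \<tau> = a" by (auto simp: constant_on_def)
    then have "?D \<tau> = ?D 0" by metis
    moreover have "?D 0 = 0" by (simp add: h_def)
    ultimately show ?thesis by simp
  qed
  have "linear (\<lambda>\<tau>. h \<tau> / (2 * pi))"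
    by (rule continuous_additive_imp_linear)
      (auto intro!: continuous_intros conth simp: add add_divide_distrib)
  then have "bounded_linear (\<lambda>\<tau>. h \<tau> / (2 * pi))" by (simp only: linear_conv_bounded_linear)
  then have "chi \<tau> = cis (2 * pi * blinfun_apply (Blinfun (\<lambda>\<tau>. h \<tau> / (2 * pi))) \<tau>)" for \<tau>
    by (simp add: bounded_linear_Blinfun_apply chi_h)
  then show ?thesis by blast
qed

definition diag_mat :: "('n \<Rightarrow> complex) \<Rightarrow> complex^'n^'n" where
  "diag_mat f = (\<chi> i j. if i = j then f i else 0)"

lemma diag_mat_mult_vec: "diag_mat f *v x = (\<chi> i. f i * x $ i)"
  by (simp add: diag_mat_def matrix_vector_mult_def vec_eq_iff if_distribR if_distrib cong: if_cong)

text \<open>The columns of \<open>P\<close> are a basis of common eigenvectors. The index type \<open>'n\<close> of the coordinates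
  also indexes the family \<open>mu\<close>, so that weights occur in \<open>mu\<close> with their multiplicities.\<close>

lemma bounded_group_diagonalizable:
  fixes R :: "'t::euclidean_space \<Rightarrow> complex^'n^'n"
  assumes cont: "continuous_on UNIV R" and R0: "R 0 = mat 1"
    and add: "\<And>\<sigma> \<tau>. R (\<sigma> + \<tau>) = R \<sigma> ** R \<tau>"
    and bdd: "\<And>\<tau> v. norm (R \<tau> *v v) \<le> K * norm v"
  shows "\<exists>P Q (mu :: 'n \<Rightarrow> 't \<Rightarrow>\<^sub>L real). P ** Q = mat 1 \<and> Q ** P = mat 1 \<and>
           (\<forall>\<tau>. R \<tau> ** P = P ** diag_mat (\<lambda>i. cis (2 * pi * blinfun_apply (mu i) \<tau>)))"
proof -
  have pow: "((*v) (R \<tau>) ^^ k) v = R (real k *\<^sub>R \<tau>) *v v" for k \<tau> v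
  proof (induction k)
    case (Suc k)
    then show ?case by (simp add: scaleR_left_distrib add matrix_vector_mul_assoc)
  qed (simp add: R0)
  have inv: "R (- \<tau>) *v (R \<tau> *v v) = v" for \<tau> v
    using add[of "- \<tau>" \<tau>, symmetric] by (simp add: R0 matrix_vector_mul_assoc)
  have pb: "power_bounded (R \<tau>)" for \<tau>
    unfolding power_bounded_def pow
  proof (intro exI[of _ K] allI conjI)
    fix k v
    show "norm (R (real k *\<^sub>R \<tau>) *v v) \<le> K * norm v" by (rule bdd)
    show "norm v \<le> K * norm (R (real k *\<^sub>R \<tau>) *v v)"
      using bdd[of "- (real k *\<^sub>R \<tau>)" "R (real k *\<^sub>R \<tau>) *v v"] by (simp add: inv)
  qed
  define CE where "CE = {u. \<forall>A\<in>range R. \<exists>c. A *v u = c *s u}"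
  have comm: "A ** B = B ** A" if "A \<in> range R" "B \<in> range R" for A B
  proof -
    obtain \<sigma> \<tau> where "A = R \<sigma>" "B = R \<tau>" using \<open>A \<in> range R\<close> \<open>B \<in> range R\<close> by auto
    then show ?thesis by (simp only: add[symmetric] add.commute)
  qed
  have "(UNIV :: (complex^'n) set) \<subseteq> vec.span CE"
    unfolding CE_def
    by (rule commuting_power_bounded_span_eigenvectors) (use pb comm in \<open>auto simp: vec.subspace_UNIV\<close>)
  then have spanCE: "vec.span CE = UNIV" by blast
  have char: "\<exists>\<nu> :: 't \<Rightarrow>\<^sub>L real. \<forall>\<tau>. R \<tau> *v u = cis (2 * pi * blinfun_apply \<nu> \<tau>) *s u"
    if uCE: "u \<in> CE" and u0: "u \<noteq> 0" for u
  proof -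
    obtain i where i: "u $ i \<noteq> 0" using u0 by (auto simp: vec_eq_iff)
    define ch where "ch \<tau> = (R \<tau> *v u) $ i / u $ i" for \<tau>
    have ch: "R \<tau> *v u = ch \<tau> *s u" for \<tau>
    proof -
      obtain c where c: "R \<tau> *v u = c *s u" using uCE by (auto simp: CE_def)
      then have "ch \<tau> = c" using i by (simp add: ch_def)
      then show ?thesis using c by simp
    qed
    have "\<exists>\<nu> :: 't \<Rightarrow>\<^sub>L real. \<forall>\<tau>. ch \<tau> = cis (2 * pi * blinfun_apply \<nu> \<tau>)"
    proof (rule bounded_continuous_character)
      show "continuous_on UNIV ch"
        unfolding ch_def matrix_vector_mult_def using i
        by (auto intro!: continuous_intros cont)
      fix \<sigma> \<tau>
      have "ch (\<sigma> + \<tau>) *s u = R (\<sigma> + \<tau>) *v u" by (rule ch[symmetric])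
      also have "\<dots> = R \<sigma> *v (R \<tau> *v u)" by (simp add: add matrix_vector_mul_assoc)
      also have "\<dots> = (ch \<sigma> * ch \<tau>) *s u"
        by (simp add: ch[of \<tau>] ch[of \<sigma>] vector_scalar_commute mult.commute)
      finally have "ch (\<sigma> + \<tau>) *s u = (ch \<sigma> * ch \<tau>) *s u" .
      then show "ch (\<sigma> + \<tau>) = ch \<sigma> * ch \<tau>" using u0 by simp
      have "ch 0 *s u = 1 *s u" using ch[of 0] by (simp add: R0)
      then show "ch 0 = 1" using u0 vec.scale_cancel_right[of "ch 0" u 1] by blast
      have "norm (ch \<tau>) * norm u \<le> K * norm u"
        using bdd[of \<tau> u] by (simp add: ch norm_vector_smult)
      then show "norm (ch \<tau>) \<le> K" using u0 by simp
    qed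
    then show ?thesis using ch by metis
  qed
  obtain B where B: "B \<subseteq> CE" "vec.independent B" "CE \<subseteq> vec.span B" "card B = vec.dim CE"
    using vec.basis_exists[of CE] by metis
  have "vec.span B = UNIV"
    using spanCE B(3) vec.span_minimal[OF B(3) vec.subspace_span] by blast
  have "vec.dim CE = CARD('n)"
    using spanCE vec.dim_span[of CE] vec_dim_card[where 'a = complex and 'n = 'n] by simp
  then have "card B = card (UNIV :: 'n set)" using B(4) by simp
  moreover have "finite B" using B(2) by (rule vec.finiteI_independent)
  ultimately obtain b :: "'n \<Rightarrow> complex^'n" where b: "bij_betw b UNIV B"
    using finite_same_card_bij[of "UNIV :: 'n set" B] by auto
  have bB: "b j \<in> B" for j using b by (auto simp: bij_betw_def)
  have "b j \<noteq> 0" for j using bB B(2) vec.dependent_zero by metis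
  then have "\<forall>j. \<exists>\<nu> :: 't \<Rightarrow>\<^sub>L real. \<forall>\<tau>. R \<tau> *v b j = cis (2 * pi * blinfun_apply \<nu> \<tau>) *s b j"
    using bB B(1) char by blast
  then obtain mu :: "'n \<Rightarrow> 't \<Rightarrow>\<^sub>L real" where
    mu: "\<And>j \<tau>. R \<tau> *v b j = cis (2 * pi * blinfun_apply (mu j) \<tau>) *s b j" by metis
  define P where "P = (\<chi> i j. b j $ i)"
  have col: "column j P = b j" for j by (simp add: P_def column_def)
  have "columns P = B" using b by (auto simp: columns_def col bij_betw_def)
  then obtain Q where Q: "P ** Q = mat 1"
    using matrix_right_invertible_span_columns[of P] \<open>vec.span B = UNIV\<close> by auto
  then have "Q ** P = mat 1" by (simp add: matrix_left_right_inverse)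
  moreover have "R \<tau> ** P = P ** diag_mat (\<lambda>i. cis (2 * pi * blinfun_apply (mu i) \<tau>))" for \<tau>
  proof -
    have "(R \<tau> ** P) $ i $ j = (R \<tau> *v b j) $ i" for i j
      by (simp add: matrix_matrix_mult_def matrix_vector_mult_def P_def)
    moreover have "(P ** diag_mat f) $ i $ j = f j * b j $ i" for f i j
      by (simp add: matrix_matrix_mult_def diag_mat_def P_def if_distribR if_distrib mult.commute cong: if_cong)
    ultimately show ?thesis by (simp add: vec_eq_iff mu)
  qed
  ultimately show ?thesis using Q by blast
qed

section \<open>Weight multiplicities of tensor powers\<close>



text \<open>Expansion of a product of sums; it is what makes tensor powers multiplicative.\<close>

lemma prod_sum_words:
  fixes g :: "nat \<Rightarrow> 'n::finite \<Rightarrow> 'a::comm_semiring_1"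
  shows "(\<Prod>k<N. \<Sum>m\<in>UNIV. g k m) = (\<Sum>ms\<in>words N. \<Prod>k<N. g k (ms ! k))"
proof (induction N arbitrary: g)
  case (Suc N)
  have "(\<Prod>k<Suc N. \<Sum>m\<in>UNIV. g k m) = (\<Sum>m\<in>UNIV. g 0 m) * (\<Sum>ms\<in>words N. \<Prod>k<N. g (Suc k) (ms ! k))"
    unfolding prod.lessThan_Suc_shift Suc.IH[of "\<lambda>k. g (Suc k)", symmetric] by simp
  also have "\<dots> = (\<Sum>ms\<in>words (Suc N). \<Prod>k<Suc N. g k (ms ! k))"
    by (simp add: sum_words_Suc prod.lessThan_Suc_shift sum_distrib_left sum_distrib_right del: prod.lessThan_Suc) 
      (rule sum.swap)
  finally show ?case .
qed simp

lemma tensor_action_eq: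
  "tensor_action N B u = (\<lambda>is. if is \<in> words N then \<Sum>js\<in>words N. (\<Prod>k<N. B $ (is ! k) $ (js ! k)) * u js else 0)"
  unfolding tensor_action_def words_def by simp

lemma tensor_action_mult:
  "tensor_action N (A ** B) u = tensor_action N A (tensor_action N B u)"
proof
  fix "is"
  have "(\<Sum>js\<in>words N. (\<Prod>k<N. (A ** B) $ (is ! k) $ (js ! k)) * u js)
      = (\<Sum>js\<in>words N. \<Sum>ms\<in>words N. (\<Prod>k<N. A $ (is ! k) $ (ms ! k)) * ((\<Prod>k<N. B $ (ms ! k) $ (js ! k)) * u js))"
    by (simp add: matrix_matrix_mult_def prod_sum_words prod.distrib sum_distrib_right mult.assoc)
  also have "\<dots> = (\<Sum>ms\<in>words N. (\<Prod>k<N. A $ (is ! k) $ (ms ! k)) * (\<Sum>js\<in>words N. (\<Prod>k<N. B $ (ms ! k) $ (js ! k)) * u js))"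
    by (subst sum.swap) (simp add: sum_distrib_left)
  finally show "tensor_action N (A ** B) u is = tensor_action N A (tensor_action N B u) is"
    by (simp add: tensor_action_eq cong: sum.cong)
qed

lemma tensor_action_diag:
  assumes "u \<in> tensor_power N"
  shows "tensor_action N (diag_mat f) u = (\<lambda>is. (\<Prod>i\<leftarrow>is. f i) * u is)"
proof
  fix "is"
  show "tensor_action N (diag_mat f) u is = (\<Prod>i\<leftarrow>is. f i) * u is"
  proof (cases "is \<in> words N")
    case True
    have "(\<Prod>k<N. diag_mat f $ (is ! k) $ (js ! k)) = (if js = is then (\<Prod>i\<leftarrow>is. f i) else 0)"
      if "js \<in> words N" for js
    proof (cases "js = is")
      case True
      then show ?thesis using \<open>is \<in> words N\<close>
        by (simp add: diag_mat_def prod.list_conv_set_nth words_def atLeast0LessThan)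
    next
      case False
      then obtain k where "k < N" "is ! k \<noteq> js ! k"
        using \<open>is \<in> words N\<close> \<open>js \<in> words N\<close> by (auto simp: words_def list_eq_iff_nth_eq)
      then have "\<exists>k\<in>{..<N}. diag_mat f $ (is ! k) $ (js ! k) = 0"
        by (auto simp: diag_mat_def)
      then show ?thesis using False by (simp add: prod_zero)
    qed
    then have "(\<Sum>js\<in>words N. (\<Prod>k<N. diag_mat f $ (is ! k) $ (js ! k)) * u js)
        = (\<Sum>js\<in>words N. if js = is then (\<Prod>i\<leftarrow>is. f i) * u js else 0)"
      by (intro sum.cong refl) simp
    then show ?thesis using True by (simp add: tensor_action_eq)
  qed (use assms in \<open>simp add: tensor_action_eq tensor_power_def words_def\<close>)
qed

lemma tensor_action_mat_1:
  assumes "u \<in> tensor_power N"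
  shows "tensor_action N (mat 1) u = u"
proof -
  have "mat 1 = diag_mat (\<lambda>_ :: 'a. 1)" by (simp add: mat_def diag_mat_def)
  then show ?thesis
    using tensor_action_diag[OF assms, of "\<lambda>_. 1"] by (simp add: map_replicate_const)
qed

text \<open>If \<open>a - b\<close> took a nonzero value, then by scaling it would take the value \<open>1/2\<close>, which is no integer.\<close>

lemma cis_eq_imp_eq:
  fixes a b :: "'t::euclidean_space \<Rightarrow>\<^sub>L real"
  assumes "\<And>\<tau>. cis (2 * pi * blinfun_apply a \<tau>) = cis (2 * pi * blinfun_apply b \<tau>)"
  shows "a = b"
proof (rule blinfun_eqI)
  fix \<tau>
  have int: "blinfun_apply (a - b) \<sigma> \<in> \<int>" for \<sigma>
  proof -
    have "cis (2 * pi * blinfun_apply (a - b) \<sigma>) = 1"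
      using assms[of \<sigma>] by (simp add: blinfun.diff_left right_diff_distrib cis_divide[symmetric])
    then have "cos (2 * pi * blinfun_apply (a - b) \<sigma>) = 1" by (simp add: complex_eq_iff)
    then obtain k :: int where "2 * pi * blinfun_apply (a - b) \<sigma> = 2 * pi * of_int k"
      by (auto simp: cos_one_2pi_int)
    then show ?thesis by simp
  qed
  show "blinfun_apply a \<tau> = blinfun_apply b \<tau>"
  proof (rule ccontr)
    assume ne: "blinfun_apply a \<tau> \<noteq> blinfun_apply b \<tau>"
    define r where "r = blinfun_apply (a - b) \<tau>"
    have "r \<noteq> 0" using ne by (simp add: r_def blinfun.diff_left)
    then have "blinfun_apply (a - b) ((1 / (2 * r)) *\<^sub>R \<tau>) = 1 / 2"
      by (simp add: blinfun.scaleR_right r_def[symmetric])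
    then have "(1 / 2 :: real) \<in> \<int>" using int by metis
    then show False by (auto elim!: Ints_cases) 
  qed
qed

definition words_with_sum :: "('n \<Rightarrow> 't::euclidean_space \<Rightarrow>\<^sub>L real) \<Rightarrow> nat \<Rightarrow> ('t \<Rightarrow>\<^sub>L real) \<Rightarrow> 'n list set" where
  "words_with_sum mu N \<nu> = {is\<in>words N. sum_list (map mu is) = \<nu>}"

lemma card_words_sum_in:
  assumes "finite Y"
  shows "card {is\<in>words N. sum_list (map mu is) \<in> Y} = (\<Sum>\<nu>\<in>Y. card (words_with_sum (mu :: 'n::finite \<Rightarrow> 't::euclidean_space \<Rightarrow>\<^sub>L real) N \<nu>))"
proof -
  have "{is\<in>words N. sum_list (map mu is) \<in> Y} = (\<Union>\<nu>\<in>Y. words_with_sum mu N \<nu>)"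
    by (auto simp: words_with_sum_def)
  also have "card \<dots> = (\<Sum>\<nu>\<in>Y. card (words_with_sum mu N \<nu>))"
    using assms by (intro card_UN_disjoint) (auto simp: words_with_sum_def)
  finally show ?thesis .
qed

lemma words_with_sum_1: "words_with_sum mu 1 \<nu> = (\<lambda>i. [i]) ` {i. mu i = \<nu>}"
  by (auto simp: words_with_sum_def words_def length_Suc_conv)

lemma card_words_with_sum_1: "card (words_with_sum mu 1 \<nu>) = card {i. mu i = \<nu>}"
  unfolding words_with_sum_1 by (rule card_image) (simp add: inj_on_def)

lemma prod_list_cis: "(\<Prod>i\<leftarrow>is. cis (f i)) = cis (\<Sum>i\<leftarrow>is. f i)"
  by (induction "is") (simp_all add: cis_mult)

lemma tensor_action_in_tensor_power: "tensor_action N B u \<in> tensor_power N"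
  by (simp add: tensor_action_def tensor_power_def)

text \<open>The base change \<open>P\<close> carries the weight space of the diagonal action to that of \<open>\<rho>\<close>. The diagonal
  action multiplies the coefficient at a word by the character of the sum of its weights, and
  distinct weights have distinct characters, so the weight space of the diagonal action consists of
  the vectors supported on the words with sum \<open>\<nu>\<close>.\<close>

lemma weight_space_eq_image:
  fixes \<rho> :: "'g \<Rightarrow> complex^'n^'n" and e :: "'t::euclidean_space \<Rightarrow> 'g"
    and mu :: "'n \<Rightarrow> 't \<Rightarrow>\<^sub>L real"
  assumes PQ: "P ** Q = mat 1" "Q ** P = mat 1"
    and diag: "\<And>\<tau>. \<rho> (e \<tau>) ** P = P ** diag_mat (\<lambda>i. cis (2 * pi * blinfun_apply (mu i) \<tau>))"
  shows "weight_space e \<rho> N \<nu> = tensor_action N P ` {u. \<forall>is. is \<notin> words_with_sum mu N \<nu> \<longrightarrow> u is = 0}"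
proof -
  let ?D = "\<lambda>\<tau>. diag_mat (\<lambda>i. cis (2 * pi * blinfun_apply (mu i) \<tau>)) :: complex^'n^'n"
  let ?T = "tensor_action N"
  have act_D: "?T (?D \<tau>) u = (\<lambda>is. cis (2 * pi * blinfun_apply (sum_list (map mu is)) \<tau>) * u is)"
    if "u \<in> tensor_power N" for \<tau> u
    by (simp add: tensor_action_diag[OF that] prod_list_cis blinfun_apply_sum_list sum_list_const_mult)
  have scale: "?T B (\<lambda>is. c * u is) = (\<lambda>is. c * ?T B u is)" for B c and u :: "'n list \<Rightarrow> complex"
    by (simp add: tensor_action_eq sum_distrib_left mult_ac fun_eq_iff)
  have conj: "?T (\<rho> (e \<tau>)) (?T P u) = ?T P (?T (?D \<tau>) u)" for \<tau> u
    by (simp add: tensor_action_mult[symmetric] diag)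
  have PQ': "?T P (?T Q u) = u" and QP': "?T Q (?T P u) = u" if "u \<in> tensor_power N" for u
    using that by (simp_all add: tensor_action_mult[symmetric] PQ tensor_action_mat_1)
  have supp: "u \<in> tensor_power N \<and> (\<forall>\<tau>. ?T (?D \<tau>) u = (\<lambda>is. cis (2 * pi * blinfun_apply \<nu> \<tau>) * u is))
       \<longleftrightarrow> (\<forall>is. is \<notin> words_with_sum mu N \<nu> \<longrightarrow> u is = 0)" for u
  proof
    assume u: "u \<in> tensor_power N \<and> (\<forall>\<tau>. ?T (?D \<tau>) u = (\<lambda>is. cis (2 * pi * blinfun_apply \<nu> \<tau>) * u is))"
    show "\<forall>is. is \<notin> words_with_sum mu N \<nu> \<longrightarrow> u is = 0"
    proof (intro allI impI, rule ccontr)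
      fix "is" assume "is \<notin> words_with_sum mu N \<nu>" and nz: "u is \<noteq> 0"
      moreover from nz have "is \<in> words N" using u by (auto simp: tensor_power_def words_def)
      ultimately have "sum_list (map mu is) \<noteq> \<nu>" by (simp add: words_with_sum_def)
      moreover have "cis (2 * pi * blinfun_apply (sum_list (map mu is)) \<tau>) = cis (2 * pi * blinfun_apply \<nu> \<tau>)" for \<tau>
      proof -
        have "cis (2 * pi * blinfun_apply (sum_list (map mu is)) \<tau>) * u is = ?T (?D \<tau>) u is"
          unfolding act_D[OF conjunct1[OF u]] ..
        also have "\<dots> = cis (2 * pi * blinfun_apply \<nu> \<tau>) * u is"
          unfolding spec[OF conjunct2[OF u]] ..
        finally show ?thesis using nz by simp
      qed
      ultimately show False using cis_eq_imp_eq by blast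
    qed
  next
    assume u: "\<forall>is. is \<notin> words_with_sum mu N \<nu> \<longrightarrow> u is = 0"
    then have ut: "u \<in> tensor_power N" by (auto simp: tensor_power_def words_with_sum_def words_def)
    moreover have "cis (2 * pi * blinfun_apply (sum_list (map mu is)) \<tau>) * u is = cis (2 * pi * blinfun_apply \<nu> \<tau>) * u is" for "is" \<tau>
      using u by (cases "is \<in> words_with_sum mu N \<nu>") (auto simp: words_with_sum_def)
    ultimately show "u \<in> tensor_power N \<and> (\<forall>\<tau>. ?T (?D \<tau>) u = (\<lambda>is. cis (2 * pi * blinfun_apply \<nu> \<tau>) * u is))"
      by (auto simp only: act_D)
  qed
  show ?thesis
  proof (intro subset_antisym subsetI)
    fix u assume u: "u \<in> weight_space e \<rho> N \<nu>"
    then have ut: "u \<in> tensor_power N"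
      and uw: "\<And>\<tau>. ?T (\<rho> (e \<tau>)) u = (\<lambda>is. cis (2 * pi * blinfun_apply \<nu> \<tau>) * u is)"
      by (auto simp: weight_space_def)
    have "?T (?D \<tau>) (?T Q u) = (\<lambda>is. cis (2 * pi * blinfun_apply \<nu> \<tau>) * ?T Q u is)" for \<tau>
    proof -
      have "?T (?D \<tau>) (?T Q u) = ?T Q (?T P (?T (?D \<tau>) (?T Q u)))"
        by (simp add: QP' tensor_action_in_tensor_power)
      also have "\<dots> = ?T Q (?T (\<rho> (e \<tau>)) u)" by (simp add: conj[symmetric] PQ' ut)
      finally show ?thesis by (simp add: uw scale)
    qed
    then have "\<forall>is. is \<notin> words_with_sum mu N \<nu> \<longrightarrow> ?T Q u is = 0"
      using supp[of "?T Q u"] tensor_action_in_tensor_power by blast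
    then show "u \<in> ?T P ` {u. \<forall>is. is \<notin> words_with_sum mu N \<nu> \<longrightarrow> u is = 0}"
      by (intro image_eqI[of _ _ "?T Q u"]) (simp_all add: PQ' ut)
  next
    fix u assume "u \<in> ?T P ` {u. \<forall>is. is \<notin> words_with_sum mu N \<nu> \<longrightarrow> u is = 0}"
    then obtain v where v: "u = ?T P v" "\<forall>is. is \<notin> words_with_sum mu N \<nu> \<longrightarrow> v is = 0" by auto
    have "?T (\<rho> (e \<tau>)) u = (\<lambda>is. cis (2 * pi * blinfun_apply \<nu> \<tau>) * u is)" for \<tau>
      using v(2) supp[of v] unfolding v(1) conj by (simp add: scale)
    then show "u \<in> weight_space e \<rho> N \<nu>"
      using v(1) tensor_action_in_tensor_power by (auto simp: weight_space_def)
  qed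
qed

lemma vector_space_fun: "vector_space (\<lambda>(c::complex) u (x::'x). c * u x)"
  by unfold_locales (simp_all add: fun_eq_iff algebra_simps plus_fun_def)

text \<open>A basis of the weight space is given by the images under \<open>P\<close> of the unit vectors at the words with
  sum \<open>\<nu>\<close>.\<close>

lemma weight_mult_eq_card:
  fixes \<rho> :: "'g \<Rightarrow> complex^'n^'n" and e :: "'t::euclidean_space \<Rightarrow> 'g"
    and mu :: "'n \<Rightarrow> 't \<Rightarrow>\<^sub>L real"
  assumes PQ: "P ** Q = mat 1" "Q ** P = mat 1"
    and diag: "\<And>\<tau>. \<rho> (e \<tau>) ** P = P ** diag_mat (\<lambda>i. cis (2 * pi * blinfun_apply (mu i) \<tau>))"
  shows "weight_mult e \<rho> N \<nu> = card (words_with_sum mu N \<nu>)"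
proof -
  let ?s = "\<lambda>(c::complex) u (x::'n list). c * u x"
  let ?T = "tensor_action N"
  let ?L = "words_with_sum mu N \<nu>"
  let ?V = "{u :: 'n list \<Rightarrow> complex. \<forall>is. is \<notin> ?L \<longrightarrow> u is = 0}"
  define \<delta> where "\<delta> js = (\<lambda>is. if is = js then 1 else 0 :: complex)" for js :: "'n list"
  interpret fs: vector_space ?s by (rule vector_space_fun)
  interpret fp: vector_space_pair ?s ?s by unfold_locales
  have finL: "finite ?L" by (simp add: words_with_sum_def)
  have lin: "Vector_Spaces.linear ?s ?s (?T B)" for B
    by (unfold_locales) (auto simp: tensor_action_eq fun_eq_iff plus_fun_def sum_distrib_left sum.distrib algebra_simps)
  have inj\<delta>: "inj_on \<delta> ?L" by (auto simp: inj_on_def \<delta>_def fun_eq_iff)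
  have sum\<delta>: "(\<Sum>js\<in>?L. ?s (u js) (\<delta> js)) is = (if is \<in> ?L then u is else 0)" for u "is"
  proof -
    have "(\<Sum>js\<in>?L. ?s (u js) (\<delta> js)) is = (\<Sum>js\<in>?L. u js * \<delta> js is)"
      using finL by (induction rule: finite_induct) (simp_all add: plus_fun_def zero_fun_def)
    then show ?thesis using finL by (simp add: \<delta>_def if_distrib cong: if_cong)
  qed
  have subV: "fs.subspace ?V" by (rule fs.subspaceI) (auto simp: plus_fun_def zero_fun_def)
  have spanV: "fs.span (\<delta> ` ?L) = ?V"
  proof (intro subset_antisym)
    show "fs.span (\<delta> ` ?L) \<subseteq> ?V"
      by (rule fs.span_minimal[OF _ subV]) (auto simp: \<delta>_def)
    show "?V \<subseteq> fs.span (\<delta> ` ?L)"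
    proof
      fix u assume "u \<in> ?V"
      then have "u = (\<Sum>js\<in>?L. ?s (u js) (\<delta> js))" by (intro ext) (simp add: sum\<delta>)
      also have "\<dots> \<in> fs.span (\<delta> ` ?L)" by (intro fs.span_sum fs.span_scale fs.span_base imageI)
      finally show "u \<in> fs.span (\<delta> ` ?L)" .
    qed
  qed
  have ind: "fs.independent (\<delta> ` ?L)"
  proof (rule fs.independent_if_scalars_zero)
    fix f x assume sum0: "(\<Sum>x\<in>\<delta> ` ?L. ?s (f x) x) = 0" and x: "x \<in> \<delta> ` ?L"
    obtain js where js: "js \<in> ?L" "x = \<delta> js" using x by blast
    have "(\<Sum>js\<in>?L. ?s (f (\<delta> js)) (\<delta> js)) = 0" using sum0 by (simp add: sum.reindex[OF inj\<delta>])
    then have "(\<Sum>js\<in>?L. ?s (f (\<delta> js)) (\<delta> js)) js = 0" by (simp add: zero_fun_def)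
    then show "f x = 0" using sum\<delta>[of "\<lambda>js. f (\<delta> js)" js] js by simp
  qed (simp add: finL)
  have VT: "?V \<subseteq> tensor_power N" by (auto simp: tensor_power_def words_with_sum_def words_def)
  have inj: "inj_on (?T P) (fs.span (\<delta> ` ?L))"
  proof (rule inj_on_inverseI[of _ "?T Q"])
    fix u assume "u \<in> fs.span (\<delta> ` ?L)"
    then have "u \<in> tensor_power N" using spanV VT by auto
    then show "?T Q (?T P u) = u" by (simp add: tensor_action_mult[symmetric] PQ tensor_action_mat_1)
  qed
  have "fs.span (?T P ` \<delta> ` ?L) = ?T P ` ?V"
    unfolding spanV[symmetric] by (rule fp.linear_span_image[OF lin])
  moreover have "fs.independent (?T P ` \<delta> ` ?L)"
    by (rule fp.linear_independent_injective_image[OF lin ind inj])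
  moreover have "card (?T P ` \<delta> ` ?L) = card ?L"
    using inj_on_subset[OF inj fs.span_superset] inj\<delta> by (simp add: card_image)
  ultimately have "fs.dim (?T P ` ?V) = card ?L"
    by (metis fs.dim_span_eq_card_independent fs.dim_span)
  then show ?thesis
    by (simp add: weight_mult_def weight_space_eq_image[where e = e and \<rho> = \<rho>, OF PQ diag])
qed

section \<open>The Weyl group\<close>

lemma torus_exponential_zero:
  assumes "group G" "torus_exponential G X T e" "topspace X = carrier G"
  shows "e 0 = \<one>\<^bsub>G\<^esub>"
proof -
  interpret group G by fact
  have "e 0 \<in> carrier G"
    using assms by (auto simp: torus_exponential_def continuous_map_def)
  moreover have "e 0 \<otimes>\<^bsub>G\<^esub> e 0 = e 0"
    using assms(2) unfolding torus_exponential_def by (metis add.right_neutral)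
  ultimately show ?thesis by (simp add: l_cancel_one)
qed

text \<open>The normalizer condition on \<open>n\<close> follows from the intertwining relation, because \<open>e\<close> maps onto \<open>T\<close>.\<close>

lemma weyl_group_intro:
  assumes "group G" "torus_exponential G X T e" "linear w" "surj w" "n \<in> carrier G"
    and "\<And>\<tau>. e (w \<tau>) = n \<otimes>\<^bsub>G\<^esub> e \<tau> \<otimes>\<^bsub>G\<^esub> inv\<^bsub>G\<^esub> n"
  shows "w \<in> weyl_group G T e"
proof -
  have T: "T = range e" using assms(2) by (simp add: torus_exponential_def)
  have "(\<lambda>t. n \<otimes>\<^bsub>G\<^esub> t \<otimes>\<^bsub>G\<^esub> inv\<^bsub>G\<^esub> n) ` T = range (\<lambda>\<tau>. e (w \<tau>))"
    unfolding T by (simp add: assms(6) image_image)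
  also have "\<dots> = T" unfolding T using \<open>surj w\<close> by (metis image_image)
  finally show ?thesis using assms unfolding weyl_group_def by blast
qed

text \<open>A vector killed by \<open>w\<close> spans a line in the kernel of \<open>e\<close>, which is discrete; so
  \<open>w\<close> is invertible, and the inverse of \<open>n\<close> represents its inverse.\<close>

lemma weyl_group_inverse:
  fixes e :: "'t::euclidean_space \<Rightarrow> 'g"
  assumes G: "group G" and te: "torus_exponential G X T e" and X: "topspace X = carrier G"
    and w: "w \<in> weyl_group G T e"
  obtains v where "v \<in> weyl_group G T e" "\<And>\<tau>. v (w \<tau>) = \<tau>" "\<And>\<tau>. w (v \<tau>) = \<tau>"
proof -
  interpret group G by fact
  have ec: "e \<tau> \<in> carrier G" for \<tau>
    using te X by (auto simp: torus_exponential_def continuous_map_def)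
  obtain n where n: "linear w" "n \<in> carrier G" "\<And>\<tau>. e (w \<tau>) = n \<otimes>\<^bsub>G\<^esub> e \<tau> \<otimes>\<^bsub>G\<^esub> inv\<^bsub>G\<^esub> n"
    using w by (auto simp: weyl_group_def)
  have undo: "e \<tau> = inv\<^bsub>G\<^esub> n \<otimes>\<^bsub>G\<^esub> e (w \<tau>) \<otimes>\<^bsub>G\<^esub> n" for \<tau>
    using n(2) ec[of \<tau>] unfolding n(3) by (simp add: m_assoc inv_solve_left')
      (simp add: m_assoc[symmetric])
  obtain \<epsilon> where \<epsilon>: "\<epsilon> > 0" "\<And>\<tau>. norm \<tau> < \<epsilon> \<Longrightarrow> e \<tau> = \<one>\<^bsub>G\<^esub> \<Longrightarrow> \<tau> = 0"
    using te by (auto simp: torus_exponential_def)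
  have "\<tau> = 0" if "w \<tau> = 0" for \<tau>
  proof (rule ccontr)
    assume "\<tau> \<noteq> 0"
    define \<sigma> where "\<sigma> = (\<epsilon> / (2 * norm \<tau>)) *\<^sub>R \<tau>"
    have "w \<sigma> = 0" using that by (simp add: \<sigma>_def linear_cmul[OF n(1)])
    then have "e \<sigma> = \<one>\<^bsub>G\<^esub>"
      using undo[of \<sigma>] n(2) torus_exponential_zero[OF G te X] by simp
    moreover have "norm \<sigma> < \<epsilon>" using \<epsilon>(1) \<open>\<tau> \<noteq> 0\<close> by (simp add: \<sigma>_def)
    ultimately have "\<sigma> = 0" by (intro \<epsilon>(2))
    then show False using \<epsilon>(1) \<open>\<tau> \<noteq> 0\<close> by (simp add: \<sigma>_def)
  qed
  then have "inj w" by (simp add: linear_injective_0[OF n(1)])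
  then obtain v where v: "linear v" "\<And>\<tau>. v (w \<tau>) = \<tau>" "\<And>\<tau>. w (v \<tau>) = \<tau>"
    using linear_injective_isomorphism[OF n(1)] by blast
  have "v \<in> weyl_group G T e"
  proof (rule weyl_group_intro[OF G te v(1)])
    show "surj v" using v(2) by (metis surjI)
    show "inv\<^bsub>G\<^esub> n \<in> carrier G" using n(2) by simp
    show "e (v \<tau>) = inv\<^bsub>G\<^esub> n \<otimes>\<^bsub>G\<^esub> e \<tau> \<otimes>\<^bsub>G\<^esub> inv\<^bsub>G\<^esub> (inv\<^bsub>G\<^esub> n)" for \<tau>
      using undo[of "v \<tau>"] n(2) by (simp add: v(3))
  qed
  then show ?thesis using v that by blast
qed

lemma weyl_group_compose:
  fixes e :: "'t::euclidean_space \<Rightarrow> 'g"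
  assumes G: "group G" and te: "torus_exponential G X T e" and X: "topspace X = carrier G"
    and w: "w \<in> weyl_group G T e" and v: "v \<in> weyl_group G T e"
  shows "(\<lambda>\<tau>. w (v \<tau>)) \<in> weyl_group G T e"
proof -
  interpret group G by fact
  have ec: "e \<tau> \<in> carrier G" for \<tau>
    using te X by (auto simp: torus_exponential_def continuous_map_def)
  obtain n where n: "linear w" "n \<in> carrier G" "\<And>\<tau>. e (w \<tau>) = n \<otimes>\<^bsub>G\<^esub> e \<tau> \<otimes>\<^bsub>G\<^esub> inv\<^bsub>G\<^esub> n"
    using w by (auto simp: weyl_group_def)
  obtain m where m: "linear v" "m \<in> carrier G" "\<And>\<tau>. e (v \<tau>) = m \<otimes>\<^bsub>G\<^esub> e \<tau> \<otimes>\<^bsub>G\<^esub> inv\<^bsub>G\<^esub> m"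
    using v by (auto simp: weyl_group_def)
  show ?thesis
  proof (rule weyl_group_intro[OF G te])
    show "linear (\<lambda>\<tau>. w (v \<tau>))" using linear_compose[OF m(1) n(1)] by (simp add: o_def)
    obtain w' where w': "\<And>\<tau>. w (w' \<tau>) = \<tau>" using weyl_group_inverse[OF G te X w] by blast
    obtain v' where v': "\<And>\<tau>. v (v' \<tau>) = \<tau>" using weyl_group_inverse[OF G te X v] by blast
    show "surj (\<lambda>\<tau>. w (v \<tau>))" by (rule surjI[of _ "\<lambda>\<tau>. v' (w' \<tau>)"]) (simp add: w' v')
    show "n \<otimes>\<^bsub>G\<^esub> m \<in> carrier G" using n m by simp
    show "e (w (v \<tau>)) = (n \<otimes>\<^bsub>G\<^esub> m) \<otimes>\<^bsub>G\<^esub> e \<tau> \<otimes>\<^bsub>G\<^esub> inv\<^bsub>G\<^esub> (n \<otimes>\<^bsub>G\<^esub> m)" for \<tau>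
      using n(2) m(2) ec by (simp add: n(3) m(3) m_assoc inv_mult_group)
  qed
qed

lemma weyl_group_id:
  assumes G: "group G" and te: "torus_exponential G X T e" and X: "topspace X = carrier G"
  shows "(\<lambda>\<tau>. \<tau>) \<in> weyl_group G T e"
proof -
  interpret group G by fact
  have ec: "e \<tau> \<in> carrier G" for \<tau>
    using te X by (auto simp: torus_exponential_def continuous_map_def)
  show ?thesis
    by (rule weyl_group_intro[OF G te, of _ "\<one>\<^bsub>G\<^esub>"]) (auto simp: ec linear_id[unfolded id_def])
qed

text \<open>The group \<open>G\<close> is compact, so its conjugations are equicontinuous at the identity. The image under
  \<open>e\<close> of a small sphere avoids the identity; by equicontinuity no Weyl group element can map a
  sufficiently short vector onto that sphere, and by scaling none can map it beyond the sphere.\<close>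

lemma weyl_group_bounded:
  fixes e :: "'t::euclidean_space \<Rightarrow> 'g" and A :: "('g set \<times> ('g \<Rightarrow> 'e::euclidean_space)) set"
  assumes LG: "lie_group G X A" and comp: "compact_space X" and te: "torus_exponential G X T e"
  shows "\<exists>K. \<forall>w\<in>weyl_group G T e. \<forall>\<tau>. norm (w \<tau>) \<le> K * norm \<tau>"
proof -
  have G: "group G" and X: "topspace X = carrier G" and haus: "Hausdorff_space X"
    and mult: "continuous_map (prod_topology X X) X (\<lambda>(g, h). g \<otimes>\<^bsub>G\<^esub> h)"
    and inv: "continuous_map X X (\<lambda>g. inv\<^bsub>G\<^esub> g)"
    using LG by (auto simp: lie_group_def)
  interpret group G by fact
  have conte: "continuous_map euclidean X e" using te by (simp add: torus_exponential_def)
  have e0: "e 0 = \<one>\<^bsub>G\<^esub>" by (rule torus_exponential_zero[OF G te X])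
  obtain \<epsilon> where \<epsilon>: "\<epsilon> > 0" "\<And>\<tau>. norm \<tau> < \<epsilon> \<Longrightarrow> e \<tau> = \<one>\<^bsub>G\<^esub> \<Longrightarrow> \<tau> = 0"
    using te by (auto simp: torus_exponential_def)
  \<comment> \<open>the radius is less than the injectivity bound \<open>\<epsilon>\<close> of \<open>e\<close> at the identity\<close>
  define S where "S = e ` sphere 0 (\<epsilon> / 2)"
  have "compactin X S"
    unfolding S_def by (rule image_compactin[OF _ conte]) simp
  then have closedS: "closedin X S" using haus by (rule compactin_imp_closedin[rotated])
  have "\<one>\<^bsub>G\<^esub> \<notin> S"
  proof
    assume "\<one>\<^bsub>G\<^esub> \<in> S"
    then obtain \<tau> where \<tau>: "norm \<tau> = \<epsilon> / 2" "e \<tau> = \<one>\<^bsub>G\<^esub>" by (auto simp: S_def)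
    then show False using \<epsilon>(1) \<epsilon>(2)[of \<tau>] by simp
  qed
  define c where "c = (\<lambda>(g, t). g \<otimes>\<^bsub>G\<^esub> t \<otimes>\<^bsub>G\<^esub> inv\<^bsub>G\<^esub> g)"
  have contc: "continuous_map (prod_topology X X) X c"
  proof -
    have "continuous_map (prod_topology X X) (prod_topology X X) (\<lambda>p. ((\<lambda>(g, h). g \<otimes>\<^bsub>G\<^esub> h) p, inv\<^bsub>G\<^esub> (fst p)))"
      by (intro continuous_map_pairedI mult continuous_map_compose[OF continuous_map_fst inv, unfolded o_def])
    from continuous_map_compose[OF this mult] show ?thesis
      by (simp add: c_def o_def case_prod_unfold)
  qed
  define W where "W = {p \<in> topspace (prod_topology X X). c p \<in> topspace X - S}"
  have "openin (prod_topology X X) W"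
    unfolding W_def using closedS by (intro openin_continuous_map_preimage[OF contc]) auto
  moreover have "compactin X (topspace X)" using comp by (simp add: compact_space_def)
  moreover have "\<one>\<^bsub>G\<^esub> \<in> topspace X" using X by simp
  moreover have "topspace X \<times> {\<one>\<^bsub>G\<^esub>} \<subseteq> W"
    using X \<open>\<one>\<^bsub>G\<^esub> \<notin> S\<close> by (auto simp: W_def c_def)
  ultimately obtain U V where UV: "openin X U" "openin X V" "topspace X \<subseteq> U" "\<one>\<^bsub>G\<^esub> \<in> V" "U \<times> V \<subseteq> W"
    using tube_lemma_left by metis
  have "open {\<tau>. e \<tau> \<in> V}"
    using openin_continuous_map_preimage[OF conte UV(2)] by simp
  moreover have "0 \<in> {\<tau>. e \<tau> \<in> V}" using e0 UV(4) by simp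
  ultimately obtain \<delta> where \<delta>: "\<delta> > 0" "ball 0 \<delta> \<subseteq> {\<tau>. e \<tau> \<in> V}"
    by (rule openE)
  have small: "norm (w \<tau>) < \<epsilon> / 2" if w: "w \<in> weyl_group G T e" and \<tau>: "norm \<tau> < \<delta>" for w \<tau>
  proof (rule ccontr)
    assume "\<not> norm (w \<tau>) < \<epsilon> / 2"
    then have ge: "\<epsilon> / 2 \<le> norm (w \<tau>)" by simp
    obtain n where n: "linear w" "n \<in> carrier G" "\<And>\<tau>. e (w \<tau>) = n \<otimes>\<^bsub>G\<^esub> e \<tau> \<otimes>\<^bsub>G\<^esub> inv\<^bsub>G\<^esub> n"
      using w by (auto simp: weyl_group_def)
    \<comment> \<open>scaling by \<open>s\<close> puts the image exactly on the sphere\<close>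
    define s where "s = (\<epsilon> / 2) / norm (w \<tau>)"
    have s: "0 \<le> s" "s \<le> 1" using ge \<epsilon>(1) by (auto simp: s_def divide_le_eq_1)
    have "norm (w (s *\<^sub>R \<tau>)) = \<epsilon> / 2"
    proof -
      have "0 < norm (w \<tau>)" using ge \<epsilon>(1) by linarith
      then show ?thesis using \<epsilon>(1) by (simp add: linear_cmul[OF n(1)] s_def)
    qed
    then have "e (w (s *\<^sub>R \<tau>)) \<in> S" by (simp add: S_def)
    moreover have "norm (s *\<^sub>R \<tau>) < \<delta>"
      using s \<tau> mult_right_mono[OF s(2), of "norm \<tau>"] by simp
    then have "s *\<^sub>R \<tau> \<in> ball 0 \<delta>" by simp
    then have "e (s *\<^sub>R \<tau>) \<in> V" using \<delta>(2) by blast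
    then have "(n, e (s *\<^sub>R \<tau>)) \<in> W" using UV n(2) X by auto
    then have "e (w (s *\<^sub>R \<tau>)) \<notin> S" by (simp add: W_def c_def n(3))
    ultimately show False by blast
  qed
  show ?thesis
  proof (intro exI[of _ "\<epsilon> / \<delta>"] ballI allI)
    fix w \<tau> assume w: "w \<in> weyl_group G T e"
    then have lin: "linear w" by (auto simp: weyl_group_def)
    show "norm (w \<tau>) \<le> \<epsilon> / \<delta> * norm \<tau>"
    proof (cases "\<tau> = 0")
      case True
      then show ?thesis by (simp add: linear_0[OF lin])
    next
      case False
      have "norm (w ((\<delta> / (2 * norm \<tau>)) *\<^sub>R \<tau>)) < \<epsilon> / 2"
        using False \<delta>(1) by (intro small[OF w]) simp
      then have "\<delta> / (2 * norm \<tau>) * norm (w \<tau>) < \<epsilon> / 2"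
        using \<delta>(1) by (simp add: linear_cmul[OF lin])
      then show ?thesis using False \<delta>(1) by (simp add: field_simps)
    qed
  qed
qed

text \<open>Let \<open>w\<close> maximize \<open>\<nu>\<^sub>0(w\<tau>)\<close> up to \<open>\<epsilon>\<close>. Reflecting \<open>w\<tau>\<close> in a positive root \<open>\<alpha>\<close> with coroot \<open>h\<close> changes
  the value by \<open>-\<alpha>(w\<tau>) \<nu>\<^sub>0(h)\<close>, and this gains at most \<open>\<epsilon>\<close>. Such a \<open>w\<close> exists because
  the Weyl group is bounded.\<close>

lemma weyl_conjugate_almost_dominant:
  fixes e :: "'t::euclidean_space \<Rightarrow> 'g" and A :: "('g set \<times> ('g \<Rightarrow> 'e::euclidean_space)) set"
  assumes G: "group G" and te: "torus_exponential G X T e" and X: "topspace X = carrier G"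
    and K: "\<forall>w\<in>weyl_group G T e. \<forall>\<tau>. norm (w \<tau>) \<le> K * norm \<tau>"
    and \<nu>0: "\<nu>0 \<in> C" and \<epsilon>: "\<epsilon> > 0"
    and h: "\<And>\<alpha>. \<alpha> \<in> positive_roots G A T e C \<Longrightarrow> is_coroot G T e \<alpha> (h \<alpha>) \<and> 0 < blinfun_apply \<nu>0 (h \<alpha>)"
  obtains w where "w \<in> weyl_group G T e"
    "\<And>\<alpha>. \<alpha> \<in> positive_roots G A T e C \<Longrightarrow> - \<epsilon> / blinfun_apply \<nu>0 (h \<alpha>) \<le> blinfun_apply \<alpha> (w \<tau>)"
proof -
  let ?W = "weyl_group G T e"
  let ?S = "(\<lambda>w. blinfun_apply \<nu>0 (w \<tau>)) ` ?W"
  have ne: "?S \<noteq> {}" using weyl_group_id[OF G te X] by blast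
  have "bdd_above ?S"
  proof (intro bdd_aboveI2)
    fix w assume "w \<in> ?W"
    have "blinfun_apply \<nu>0 (w \<tau>) \<le> norm \<nu>0 * norm (w \<tau>)"
      using norm_blinfun[of \<nu>0 "w \<tau>"] by simp
    also have "\<dots> \<le> norm \<nu>0 * (K * norm \<tau>)" using K \<open>w \<in> ?W\<close> by (intro mult_left_mono) auto
    finally show "blinfun_apply \<nu>0 (w \<tau>) \<le> norm \<nu>0 * (K * norm \<tau>)" .
  qed
  then have up: "x \<le> Sup ?S" if "x \<in> ?S" for x using that by (rule cSup_upper[rotated])
  have "Sup ?S - \<epsilon> < Sup ?S" using \<epsilon> by simp
  then obtain x where "x \<in> ?S" "Sup ?S - \<epsilon> < x" using less_cSupE[OF _ ne] by blast
  then obtain w where w: "w \<in> ?W" "Sup ?S - \<epsilon> < blinfun_apply \<nu>0 (w \<tau>)" by blast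
  show ?thesis
  proof (rule that[OF w(1)])
    fix \<alpha> assume \<alpha>: "\<alpha> \<in> positive_roots G A T e C"
    have pos: "0 < blinfun_apply \<nu>0 (h \<alpha>)" using h[OF \<alpha>] by blast
    have "(\<lambda>\<tau>. \<tau> - blinfun_apply \<alpha> \<tau> *\<^sub>R h \<alpha>) \<in> ?W" using h[OF \<alpha>] by (simp add: is_coroot_def)
    from weyl_group_compose[OF G te X this w(1)]
    have "blinfun_apply \<nu>0 (w \<tau> - blinfun_apply \<alpha> (w \<tau>) *\<^sub>R h \<alpha>) \<le> Sup ?S"
      by (intro up) (rule image_eqI[rotated], assumption, rule refl)
    also have "\<dots> \<le> blinfun_apply \<nu>0 (w \<tau>) + \<epsilon>" using w(2) by simp
    finally have "- \<epsilon> \<le> blinfun_apply \<alpha> (w \<tau>) * blinfun_apply \<nu>0 (h \<alpha>)"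
      by (simp add: blinfun.diff_right blinfun.scaleR_right)
    then show "- \<epsilon> / blinfun_apply \<nu>0 (h \<alpha>) \<le> blinfun_apply \<alpha> (w \<tau>)"
      by (simp only: pos_divide_le_eq[OF pos])
  qed
qed

section \<open>Weights of a representation of a compact group\<close>

lemma matrix_vector_norm_le:
  fixes M :: "complex^'n^'n"
  shows "norm (M *v v) \<le> real CARD('n) * real CARD('n) * norm M * norm v"
proof -
  have comp: "norm ((M *v v) $ i) \<le> real CARD('n) * (norm M * norm v)" for i
  proof -
    have "norm ((M *v v) $ i) \<le> (\<Sum>j\<in>UNIV. norm (M $ i $ j * v $ j))"
      unfolding matrix_vector_mult_def by (simp add: norm_sum)
    also have "\<dots> \<le> (\<Sum>j\<in>(UNIV :: 'n set). norm M * norm v)"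
    proof (rule sum_mono)
      fix j
      have "norm (M $ i $ j) \<le> norm M"
        by (rule order_trans[OF Finite_Cartesian_Product.norm_nth_le Finite_Cartesian_Product.norm_nth_le])
      then show "norm (M $ i $ j * v $ j) \<le> norm M * norm v"
        unfolding norm_mult by (intro mult_mono Finite_Cartesian_Product.norm_nth_le) auto
    qed
    finally show ?thesis by simp
  qed
  have "norm (M *v v) \<le> (\<Sum>i\<in>UNIV. norm ((M *v v) $ i))"
    unfolding norm_vec_def by (rule L2_set_le_sum) simp
  also have "\<dots> \<le> (\<Sum>i\<in>(UNIV :: 'n set). real CARD('n) * (norm M * norm v))" by (intro sum_mono comp)
  finally show ?thesis by simp
qed

text \<open>Compactness of \<open>G\<close> bounds the matrices \<open>\<rho> (e \<tau>)\<close> uniformly.\<close>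

lemma representation_torus_diagonalizable:
  fixes \<rho> :: "'g \<Rightarrow> complex^'n^'n" and e :: "'t::euclidean_space \<Rightarrow> 'g"
  assumes G: "group G" and te: "torus_exponential G X T e" and X: "topspace X = carrier G"
    and comp: "compact_space X" and rep: "representation G X \<rho>"
  shows "\<exists>P Q (mu :: 'n \<Rightarrow> 't \<Rightarrow>\<^sub>L real). P ** Q = mat 1 \<and> Q ** P = mat 1 \<and>
           (\<forall>\<tau>. \<rho> (e \<tau>) ** P = P ** diag_mat (\<lambda>i. cis (2 * pi * blinfun_apply (mu i) \<tau>)))"
proof -
  have conte: "continuous_map euclidean X e" using te by (simp add: torus_exponential_def)
  have ec: "e \<tau> \<in> carrier G" for \<tau>
    using te X by (auto simp: torus_exponential_def continuous_map_def)
  have cont\<rho>: "continuous_map X euclidean \<rho>" using rep by (simp add: representation_def)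
  have "compactin euclidean (\<rho> ` topspace X)"
    using comp cont\<rho> by (intro image_compactin[OF _ cont\<rho>]) (simp add: compact_space_def)
  then have "bounded (\<rho> ` topspace X)" by (simp add: compact_imp_bounded)
  then obtain b where b: "\<And>g. g \<in> topspace X \<Longrightarrow> norm (\<rho> g) \<le> b" by (auto simp: bounded_iff)
  show ?thesis
  proof (rule bounded_group_diagonalizable)
    show "continuous_on UNIV (\<lambda>\<tau>. \<rho> (e \<tau>))"
      using continuous_map_compose[OF conte cont\<rho>] by (simp add: o_def)
    show "\<rho> (e 0) = mat 1"
      using rep torus_exponential_zero[OF G te X] by (simp add: representation_def)
    show "\<rho> (e (\<sigma> + \<tau>)) = \<rho> (e \<sigma>) ** \<rho> (e \<tau>)" for \<sigma> \<tau>
      using rep te ec by (simp add: representation_def torus_exponential_def)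
    fix \<tau> :: 't and v :: "complex^'n"
    have "real CARD('n) * real CARD('n) * norm (\<rho> (e \<tau>)) * norm v \<le> real CARD('n) * real CARD('n) * b * norm v"
      using b[of "e \<tau>"] ec X by (intro mult_right_mono mult_left_mono) auto
    then show "norm (\<rho> (e \<tau>) *v v) \<le> (real CARD('n) * real CARD('n) * b) * norm v"
      using matrix_vector_norm_le[of "\<rho> (e \<tau>)" v] by linarith
  qed
qed

lemma weights_eq_range:
  fixes \<rho> :: "'g \<Rightarrow> complex^'n^'n" and e :: "'t::euclidean_space \<Rightarrow> 'g"
    and mu :: "'n \<Rightarrow> 't \<Rightarrow>\<^sub>L real"
  assumes PQ: "P ** Q = mat 1" "Q ** P = mat 1"
    and diag: "\<And>\<tau>. \<rho> (e \<tau>) ** P = P ** diag_mat (\<lambda>i. cis (2 * pi * blinfun_apply (mu i) \<tau>))"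
    and rep: "representation G X \<rho>"
  shows "range mu \<subseteq> weight_lattice G e" "weights G e \<rho> = range mu"
proof -
  show sub: "range mu \<subseteq> weight_lattice G e"
  proof clarify
    fix i
    have "blinfun_apply (mu i) \<tau> \<in> \<int>" if "e \<tau> = \<one>\<^bsub>G\<^esub>" for \<tau>
    proof -
      let ?D = "diag_mat (\<lambda>i. cis (2 * pi * blinfun_apply (mu i) \<tau>)) :: complex^'n^'n"
      have "?D = Q ** (P ** ?D)" by (simp add: matrix_mul_assoc PQ)
      also have "\<dots> = Q ** (mat 1 ** P)"
        using rep that unfolding diag[symmetric] by (simp add: representation_def)
      also have "\<dots> = mat 1" by (simp add: PQ)
      finally have "?D $ i $ i = mat 1 $ i $ i" by simp
      then have "cos (2 * pi * blinfun_apply (mu i) \<tau>) = 1"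
        by (simp add: diag_mat_def mat_def complex_eq_iff)
      then obtain k :: int where "2 * pi * blinfun_apply (mu i) \<tau> = 2 * pi * of_int k"
        by (auto simp: cos_one_2pi_int)
      then show ?thesis by simp
    qed
    then show "mu i \<in> weight_lattice G e" by (simp add: weight_lattice_def integral_lattice_def)
  qed
  have "weight_mult e \<rho> 1 \<nu> \<noteq> 0 \<longleftrightarrow> \<nu> \<in> range mu" for \<nu>
    unfolding weight_mult_eq_card[where e = e and \<rho> = \<rho>, OF PQ diag] card_words_with_sum_1
    by (auto simp: card_eq_0_iff)
  then show "weights G e \<rho> = range mu" using sub unfolding weights_def by auto
qed

text \<open>In the coordinates \<open>Q\<close>, an index at which the eigenvector does not vanish picks out \<open>\<nu>\<close>.\<close>

lemma common_eigenvector_weight: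
  fixes \<rho> :: "'g \<Rightarrow> complex^'n^'n" and e :: "'t::euclidean_space \<Rightarrow> 'g"
    and mu :: "'n \<Rightarrow> 't \<Rightarrow>\<^sub>L real"
  assumes PQ: "P ** Q = mat 1" "Q ** P = mat 1"
    and diag: "\<And>\<tau>. \<rho> (e \<tau>) ** P = P ** diag_mat (\<lambda>i. cis (2 * pi * blinfun_apply (mu i) \<tau>))"
    and u: "u \<noteq> 0" "\<And>\<tau>. \<rho> (e \<tau>) *v u = cis (2 * pi * blinfun_apply \<nu> \<tau>) *s u"
  shows "\<nu> \<in> range mu"
proof -
  let ?D = "\<lambda>\<tau>. diag_mat (\<lambda>i. cis (2 * pi * blinfun_apply (mu i) \<tau>)) :: complex^'n^'n"
  have PQu: "P *v (Q *v u) = u" by (simp add: matrix_vector_mul_assoc PQ)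
  have "Q *v u \<noteq> 0" using PQu u(1) by (metis matrix_vector_mult_0_right)
  then obtain j where j: "(Q *v u) $ j \<noteq> 0" by (auto simp: vec_eq_iff)
  have "cis (2 * pi * blinfun_apply (mu j) \<tau>) = cis (2 * pi * blinfun_apply \<nu> \<tau>)" for \<tau>
  proof -
    have "?D \<tau> *v (Q *v u) = Q *v (P *v (?D \<tau> *v (Q *v u)))"
      by (simp add: matrix_vector_mul_assoc PQ matrix_mul_assoc)
    also have "\<dots> = Q *v (\<rho> (e \<tau>) *v (P *v (Q *v u)))"
      by (simp add: matrix_vector_mul_assoc diag matrix_mul_assoc)
    also have "\<dots> = cis (2 * pi * blinfun_apply \<nu> \<tau>) *s (Q *v u)"
      unfolding PQu u(2) by (simp add: vector_scalar_commute)
    finally have "(?D \<tau> *v (Q *v u)) $ j = cis (2 * pi * blinfun_apply \<nu> \<tau>) * (Q *v u) $ j" by simp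
    then show ?thesis using j by (simp add: diag_mat_mult_vec)
  qed
  then have "mu j = \<nu>" by (rule cis_eq_imp_eq)
  then show ?thesis by blast
qed

text \<open>If \<open>v\<close> is a weight vector for \<open>mu i\<close> and \<open>n\<close> represents \<open>w\<close>, then \<open>\<rho> n *v v\<close> is a weight vector for
  the transported weight.\<close>

lemma weyl_group_permutes_weights:
  fixes \<rho> :: "'g \<Rightarrow> complex^'n^'n" and e :: "'t::euclidean_space \<Rightarrow> 'g"
    and mu :: "'n \<Rightarrow> 't \<Rightarrow>\<^sub>L real"
  assumes G: "group G" and te: "torus_exponential G X T e" and X: "topspace X = carrier G"
    and rep: "representation G X \<rho>"
    and PQ: "P ** Q = mat 1" "Q ** P = mat 1"
    and diag: "\<And>\<tau>. \<rho> (e \<tau>) ** P = P ** diag_mat (\<lambda>i. cis (2 * pi * blinfun_apply (mu i) \<tau>))"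
    and w: "w \<in> weyl_group G T e" and \<nu>: "\<And>\<tau>. blinfun_apply \<nu> (w \<tau>) = blinfun_apply (mu i) \<tau>"
  shows "\<nu> \<in> range mu"
proof -
  interpret group G by fact
  have ec: "e \<tau> \<in> carrier G" for \<tau>
    using te X by (auto simp: torus_exponential_def continuous_map_def)
  have hom: "\<rho> (g \<otimes>\<^bsub>G\<^esub> h) = \<rho> g ** \<rho> h" if "g \<in> carrier G" "h \<in> carrier G" for g h
    using rep that by (simp add: representation_def)
  have one: "\<rho> \<one>\<^bsub>G\<^esub> = mat 1" using rep by (simp add: representation_def)
  obtain n where n: "n \<in> carrier G" "\<And>\<tau>. e (w \<tau>) = n \<otimes>\<^bsub>G\<^esub> e \<tau> \<otimes>\<^bsub>G\<^esub> inv\<^bsub>G\<^esub> n"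
    using w by (auto simp: weyl_group_def)
  obtain w' where w': "\<And>\<tau>. w (w' \<tau>) = \<tau>" using weyl_group_inverse[OF G te X w] by blast
  have inv_n: "\<rho> (inv\<^bsub>G\<^esub> n) ** \<rho> n = mat 1" using n(1) by (simp add: hom[symmetric] one)
  define v where "v = P *v axis i 1"
  have v0: "v \<noteq> 0"
  proof
    assume "v = 0"
    then have "Q *v (P *v axis i 1) = 0" by (simp add: v_def)
    then have "axis i (1 :: complex) = 0" by (simp add: matrix_vector_mul_assoc PQ)
    then show False by (simp add: axis_eq_0_iff)
  qed
  have v: "\<rho> (e \<tau>) *v v = cis (2 * pi * blinfun_apply (mu i) \<tau>) *s v" for \<tau>
  proof -
    have "diag_mat f *v axis i 1 = f i *s axis i 1" for f :: "'n \<Rightarrow> complex"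
      unfolding diag_mat_mult_vec by (simp add: vec_eq_iff axis_def)
    moreover have "\<rho> (e \<tau>) *v v = P *v (diag_mat (\<lambda>i. cis (2 * pi * blinfun_apply (mu i) \<tau>)) *v axis i 1)"
      by (simp only: v_def matrix_vector_mul_assoc diag)
    ultimately show ?thesis by (simp only: v_def vector_scalar_commute)
  qed
  show ?thesis
  proof (rule common_eigenvector_weight[where e = e and \<rho> = \<rho>, OF PQ diag])
    show "\<rho> n *v v \<noteq> 0"
    proof
      assume "\<rho> n *v v = 0"
      then have "\<rho> (inv\<^bsub>G\<^esub> n) *v (\<rho> n *v v) = 0" by simp
      then show False using v0 by (simp add: matrix_vector_mul_assoc inv_n)
    qed
    fix \<tau>
    have "\<rho> (e \<tau>) *v (\<rho> n *v v) = (\<rho> (n \<otimes>\<^bsub>G\<^esub> e (w' \<tau>)) ** (\<rho> (inv\<^bsub>G\<^esub> n) ** \<rho> n)) *v v"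
      using n(1) n(2)[of "w' \<tau>"] ec by (simp add: w' hom matrix_mul_assoc matrix_vector_mul_assoc)
    also have "\<dots> = \<rho> n *v (\<rho> (e (w' \<tau>)) *v v)"
      using n(1) ec by (simp add: inv_n hom matrix_vector_mul_assoc)
    also have "\<dots> = cis (2 * pi * blinfun_apply \<nu> \<tau>) *s (\<rho> n *v v)"
      using \<nu>[of "w' \<tau>"] by (simp add: v vector_scalar_commute w')
    finally show "\<rho> (e \<tau>) *v (\<rho> n *v v) = cis (2 * pi * blinfun_apply \<nu> \<tau>) *s (\<rho> n *v v)" .
  qed
qed

section \<open>The weight polytope\<close>

text \<open>A finite-dimensional vector space is reflexive, so a point outside the hull is separated from it by
  a vector \<open>\<tau>\<close>. The function \<open>r\<close> transports the situation to the Euclidean space \<open>\<t>\<close>, where the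
  separation theorem applies.\<close>

lemma support_criterion_convex_hull:
  fixes \<mu> :: "'t::euclidean_space \<Rightarrow>\<^sub>L real"
  assumes fin: "finite P" and le: "\<And>\<tau>. \<exists>\<pi>\<in>P. blinfun_apply \<mu> \<tau> \<le> blinfun_apply \<pi> \<tau>"
  shows "\<mu> \<in> convex hull P"
proof (rule ccontr)
  assume notin: "\<mu> \<notin> convex hull P"
  define r where "r \<nu> = (\<Sum>b\<in>Basis. blinfun_apply \<nu> b *\<^sub>R b)" for \<nu> :: "'t \<Rightarrow>\<^sub>L real"
  have linr: "linear r"
    by (rule linearI) (simp_all add: r_def blinfun.add_left blinfun.scaleR_left scaleR_left_distrib
        sum.distrib scaleR_sum_right)
  have r: "\<tau> \<bullet> r \<nu> = blinfun_apply \<nu> \<tau>" for \<nu> \<tau>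
  proof -
    have "\<tau> \<bullet> r \<nu> = (\<Sum>b\<in>Basis. (\<tau> \<bullet> b) * blinfun_apply \<nu> b)"
      by (simp add: r_def inner_sum_right mult.commute)
    also have "\<dots> = blinfun_apply \<nu> (\<Sum>b\<in>Basis. (\<tau> \<bullet> b) *\<^sub>R b)"
      by (simp add: blinfun.sum_right blinfun.scaleR_right)
    finally show ?thesis by (simp add: euclidean_representation)
  qed
  have "r \<mu> \<notin> convex hull (r ` P)"
  proof
    assume "r \<mu> \<in> convex hull (r ` P)"
    then obtain \<nu> where \<nu>: "\<nu> \<in> convex hull P" "r \<mu> = r \<nu>"
      by (auto simp: convex_hull_linear_image[OF linr, symmetric])
    then have "\<mu> = \<nu>" by (intro blinfun_eqI) (metis r)
    then show False using \<nu>(1) notin by simp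
  qed
  moreover have "closed (convex hull (r ` P))"
    using fin by (intro compact_imp_closed finite_imp_compact_convex_hull) auto
  ultimately obtain a b where ab: "a \<bullet> r \<mu> < b" "\<And>x. x \<in> convex hull (r ` P) \<Longrightarrow> b < a \<bullet> x"
    using separating_hyperplane_closed_point[of "convex hull (r ` P)" "r \<mu>"] by auto
  obtain \<pi> where \<pi>: "\<pi> \<in> P" "blinfun_apply \<mu> (- a) \<le> blinfun_apply \<pi> (- a)" using le by blast
  have "b < a \<bullet> r \<pi>" using \<pi>(1) by (intro ab(2) hull_inc imageI)
  then show False using ab(1) \<pi>(2) by (simp add: r blinfun.minus_right)
qed

text \<open>For a weight \<open>\<kappa>\<close> outside the hull of the orbit, some \<open>\<kappa>(\<tau>)\<close> would exceed all values of the orbit at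
  \<open>\<tau>\<close> by a positive gap. Choosing \<open>w\<close> with \<open>w\<tau>\<close> almost dominant, the value of \<open>\<lambda> - w\<kappa>\<close> at \<open>w\<tau>\<close>
  would be at most minus the gap. But \<open>\<lambda> - w\<kappa>\<close> is a nonnegative combination of positive roots, so the
  value is at least \<open>-\<epsilon>M\<close>, where the constant \<open>M\<close> serves all of the finitely many weights.\<close>

lemma weyl_polytope_eq_hull_weights:
  fixes \<rho> :: "'g \<Rightarrow> complex^'n^'n" and e :: "'t::euclidean_space \<Rightarrow> 'g"
    and mu :: "'n \<Rightarrow> 't \<Rightarrow>\<^sub>L real" and A :: "('g set \<times> ('g \<Rightarrow> 'e::euclidean_space)) set"
  assumes LG: "lie_group G X A" and comp: "compact_space X" and te: "torus_exponential G X T e"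
    and C: "C \<noteq> {}" and rep: "representation G X \<rho>"
    and hw: "highest_weight G A T e C \<rho> lam"
    and PQ: "P ** Q = mat 1" "Q ** P = mat 1"
    and diag: "\<And>\<tau>. \<rho> (e \<tau>) ** P = P ** diag_mat (\<lambda>i. cis (2 * pi * blinfun_apply (mu i) \<tau>))"
  shows "weyl_polytope G T e lam = convex hull (range mu)"
proof -
  have G: "group G" and X: "topspace X = carrier G" using LG by (auto simp: lie_group_def)
  let ?W = "weyl_group G T e" and ?R = "positive_roots G A T e C" and ?O = "weyl_orbit G T e lam"
  note weights = weights_eq_range(2)[where e = e and \<rho> = \<rho>, OF PQ diag rep]
  have perm: "\<nu> \<in> range mu" if "w \<in> ?W" "\<kappa> \<in> range mu" "\<And>\<tau>. blinfun_apply \<nu> (w \<tau>) = blinfun_apply \<kappa> \<tau>" for w \<nu> \<kappa>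
    using that weyl_group_permutes_weights[where e = e and \<rho> = \<rho>, OF G te X rep PQ diag] by blast
  have lam: "lam \<in> range mu" using hw weights by (simp add: highest_weight_def)
  have orbit: "?O \<subseteq> range mu"
    using perm[OF _ lam] by (auto simp: weyl_orbit_def)
  then have fin: "finite ?O" by (rule finite_subset) simp
  obtain K where K: "\<forall>w\<in>?W. \<forall>\<tau>. norm (w \<tau>) \<le> K * norm \<tau>"
    using weyl_group_bounded[OF LG comp te] by blast
  obtain \<nu>0 where \<nu>0: "\<nu>0 \<in> C" using C by blast
  have "\<forall>\<alpha>\<in>?R. \<exists>h. is_coroot G T e \<alpha> h \<and> 0 < blinfun_apply \<nu>0 h"
    using \<nu>0 by (auto simp: positive_roots_def)
  then obtain h where h: "\<And>\<alpha>. \<alpha> \<in> ?R \<Longrightarrow> is_coroot G T e \<alpha> (h \<alpha>) \<and> 0 < blinfun_apply \<nu>0 (h \<alpha>)"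
    by metis
  have "\<forall>\<kappa>\<in>range mu. \<exists>k::('t \<Rightarrow>\<^sub>L real) \<Rightarrow> nat. lam - \<kappa> = (\<Sum>\<alpha>\<in>?R. real (k \<alpha>) *\<^sub>R \<alpha>)"
    using hw weights by (simp add: highest_weight_def)
  then obtain k :: "('t \<Rightarrow>\<^sub>L real) \<Rightarrow> ('t \<Rightarrow>\<^sub>L real) \<Rightarrow> nat" where
    k: "\<And>\<kappa>. \<kappa> \<in> range mu \<Longrightarrow> lam - \<kappa> = (\<Sum>\<alpha>\<in>?R. real (k \<kappa> \<alpha>) *\<^sub>R \<alpha>)"
    by metis
  define height where "height \<kappa> = (\<Sum>\<alpha>\<in>?R. real (k \<kappa> \<alpha>) / blinfun_apply \<nu>0 (h \<alpha>))" for \<kappa>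
  have height0: "0 \<le> height \<kappa>" for \<kappa>
    unfolding height_def using h by (intro sum_nonneg) (simp add: less_imp_le)
  define M where "M = (\<Sum>\<kappa>\<in>range mu. height \<kappa>)"
  have M: "height \<kappa> \<le> M" if "\<kappa> \<in> range mu" for \<kappa>
    unfolding M_def using that height0 by (intro member_le_sum) auto
  have M0: "0 \<le> M" unfolding M_def by (intro sum_nonneg height0)
  have "\<kappa> \<in> convex hull ?O" if \<kappa>: "\<kappa> \<in> range mu" for \<kappa>
  proof (rule support_criterion_convex_hull[OF fin], rule ccontr)
    fix \<tau> assume "\<not> (\<exists>\<pi>\<in>?O. blinfun_apply \<kappa> \<tau> \<le> blinfun_apply \<pi> \<tau>)"
    then have less: "\<And>\<pi>. \<pi> \<in> ?O \<Longrightarrow> blinfun_apply \<pi> \<tau> < blinfun_apply \<kappa> \<tau>" by force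
    have ne: "?O \<noteq> {}"
      using weyl_group_id[OF G te X] by (auto simp: weyl_orbit_def)
    define b where "b = Max ((\<lambda>\<pi>. blinfun_apply \<pi> \<tau>) ` ?O)"
    have b: "blinfun_apply \<pi> \<tau> \<le> b" if "\<pi> \<in> ?O" for \<pi>
      unfolding b_def using that fin by (intro Max_ge) auto
    have "b \<in> (\<lambda>\<pi>. blinfun_apply \<pi> \<tau>) ` ?O" unfolding b_def using fin ne by (intro Max_in) auto
    then have gap: "0 < blinfun_apply \<kappa> \<tau> - b" using less by auto
    \<comment> \<open>dividing by \<open>M + 1\<close> makes the total error \<open>\<epsilon>M\<close> smaller than the gap\<close>
    define \<epsilon> where "\<epsilon> = (blinfun_apply \<kappa> \<tau> - b) / (M + 1)"
    have \<epsilon>: "\<epsilon> > 0" "\<epsilon> * M < blinfun_apply \<kappa> \<tau> - b"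
      using gap M0 by (auto simp: \<epsilon>_def field_simps)
    obtain w where w: "w \<in> ?W"
      "\<And>\<alpha>. \<alpha> \<in> ?R \<Longrightarrow> - \<epsilon> / blinfun_apply \<nu>0 (h \<alpha>) \<le> blinfun_apply \<alpha> (w \<tau>)"
      using weyl_conjugate_almost_dominant[where h = h and \<tau> = \<tau>, OF G te X K \<nu>0 \<epsilon>(1) h] by blast
    obtain v where v: "v \<in> ?W" "\<And>\<tau>. v (w \<tau>) = \<tau>" "\<And>\<tau>. w (v \<tau>) = \<tau>"
      using weyl_group_inverse[OF G te X w(1)] by blast
    have blin: "bounded_linear w" "bounded_linear v"
      using w(1) v(1) by (auto simp: weyl_group_def linear_conv_bounded_linear)
    define \<kappa>' where "\<kappa>' = Blinfun (\<lambda>\<sigma>. blinfun_apply \<kappa> (v \<sigma>))"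
    define \<pi> where "\<pi> = Blinfun (\<lambda>\<sigma>. blinfun_apply lam (w \<sigma>))"
    have \<kappa>': "blinfun_apply \<kappa>' \<sigma> = blinfun_apply \<kappa> (v \<sigma>)" for \<sigma>
      unfolding \<kappa>'_def by (subst bounded_linear_Blinfun_apply)
        (auto intro!: bounded_linear_compose[OF blinfun.bounded_linear_right blin(2)])
    have \<pi>: "blinfun_apply \<pi> \<sigma> = blinfun_apply lam (w \<sigma>)" for \<sigma>
      unfolding \<pi>_def by (subst bounded_linear_Blinfun_apply)
        (auto intro!: bounded_linear_compose[OF blinfun.bounded_linear_right blin(1)])
    have "\<kappa>' \<in> range mu" by (rule perm[OF w(1) \<kappa>]) (simp add: \<kappa>' v)
    have "\<pi> \<in> ?O" unfolding weyl_orbit_def using v by (auto simp: \<pi> intro!: bexI[of _ v])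
    have "- \<epsilon> * M \<le> - \<epsilon> * height \<kappa>'" using M[OF \<open>\<kappa>' \<in> range mu\<close>] \<epsilon>(1) by simp
    also have "\<dots> = (\<Sum>\<alpha>\<in>?R. real (k \<kappa>' \<alpha>) * (- \<epsilon> / blinfun_apply \<nu>0 (h \<alpha>)))"
      unfolding height_def sum_distrib_left by (intro sum.cong) auto
    also have "\<dots> \<le> (\<Sum>\<alpha>\<in>?R. real (k \<kappa>' \<alpha>) * blinfun_apply \<alpha> (w \<tau>))"
      by (intro sum_mono mult_left_mono w(2)) auto
    also have "\<dots> = blinfun_apply (lam - \<kappa>') (w \<tau>)"
      unfolding k[OF \<open>\<kappa>' \<in> range mu\<close>] by (simp add: blinfun.sum_left blinfun.scaleR_left)
    also have "\<dots> = blinfun_apply \<pi> \<tau> - blinfun_apply \<kappa> \<tau>"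
      by (simp add: blinfun.diff_left \<pi> \<kappa>' v)
    also have "\<dots> \<le> b - blinfun_apply \<kappa> \<tau>" using b[OF \<open>\<pi> \<in> ?O\<close>] by simp
    finally show False using \<epsilon>(2) by simp
  qed
  then have "range mu \<subseteq> convex hull ?O" by blast
  then have "convex hull (range mu) \<subseteq> convex hull ?O" by (intro hull_minimal) auto
  moreover have "convex hull ?O \<subseteq> convex hull (range mu)" using orbit by (rule hull_mono)
  ultimately show ?thesis by (simp add: weyl_polytope_def)
qed

section \<open>The large deviation principle for weight multiplicities\<close>

lemma weyl_polytope_scale:
  assumes "N \<ge> 1"
  shows "weyl_polytope G T e (real N *\<^sub>R lam) = (\<lambda>x. real N *\<^sub>R x) ` weyl_polytope G T e lam"
proof -
  have "weyl_orbit G T e (real N *\<^sub>R lam) = (\<lambda>x. real N *\<^sub>R x) ` weyl_orbit G T e lam"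
  proof (intro subset_antisym subsetI)
    fix \<nu> assume "\<nu> \<in> weyl_orbit G T e (real N *\<^sub>R lam)"
    then obtain w where w: "w \<in> weyl_group G T e" "\<And>\<tau>. blinfun_apply \<nu> (w \<tau>) = real N * blinfun_apply lam \<tau>"
      by (auto simp: weyl_orbit_def blinfun.scaleR_left)
    then have "(1 / real N) *\<^sub>R \<nu> \<in> weyl_orbit G T e lam"
      using assms unfolding weyl_orbit_def by (auto simp: blinfun.scaleR_left intro!: bexI[of _ w])
    then show "\<nu> \<in> (\<lambda>x. real N *\<^sub>R x) ` weyl_orbit G T e lam"
      using assms by (intro image_eqI[of _ _ "(1 / real N) *\<^sub>R \<nu>"]) auto
  next
    fix \<nu> assume "\<nu> \<in> (\<lambda>x. real N *\<^sub>R x) ` weyl_orbit G T e lam"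
    then obtain x w where "\<nu> = real N *\<^sub>R x" "w \<in> weyl_group G T e"
      "\<forall>\<tau>. blinfun_apply x (w \<tau>) = blinfun_apply lam \<tau>"
      by (auto simp: weyl_orbit_def)
    then show "\<nu> \<in> weyl_orbit G T e (real N *\<^sub>R lam)"
      unfolding weyl_orbit_def by (auto simp: blinfun.scaleR_left intro!: bexI[of _ w])
  qed
  then show ?thesis by (simp add: weyl_polytope_def convex_hull_scaling)
qed

text \<open>All sums of \<open>N\<close> weights lie in the lattice and in \<open>Q(N\<lambda>)\<close>, so no mass is lost by restricting the
  measure to these points.\<close>

lemma weight_measure_eq_mean_prob:
  fixes \<rho> :: "'g \<Rightarrow> complex^'n^'n" and e :: "'t::euclidean_space \<Rightarrow> 'g"
    and mu :: "'n \<Rightarrow> 't \<Rightarrow>\<^sub>L real"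
  assumes mult: "\<And>\<nu>. weight_mult e \<rho> N \<nu> = card (words_with_sum mu N \<nu>)"
    and lattice: "range mu \<subseteq> weight_lattice G e"
    and hull: "weyl_polytope G T e lam = convex hull (range mu)"
    and N: "N \<ge> 1" and F: "F \<in> sets (restrict_space borel (weyl_polytope G T e lam))"
  shows "emeasure (weight_measure G T e \<rho> lam N) F = ennreal (mean_prob mu N F)"
proof -
  let ?E = "weyl_polytope G T e lam"
  define \<Omega> where "\<Omega> = weyl_polytope G T e (real N *\<^sub>R lam) \<inter> weight_lattice G e"
  define g where "g \<nu> = real (weight_mult e \<rho> N \<nu>) / real CARD('n) ^ N" for \<nu>
  let ?f = "\<lambda>\<nu>. (1 / real N) *\<^sub>R \<nu> :: 't \<Rightarrow>\<^sub>L real"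
  have \<Omega>E: "?f \<nu> \<in> ?E" if "\<nu> \<in> \<Omega>" for \<nu>
    using that N by (auto simp: \<Omega>_def weyl_polytope_scale)
  have meas: "?f \<in> measurable (point_measure \<Omega> (\<lambda>\<nu>. ennreal (g \<nu>))) (restrict_space borel ?E)"
    using \<Omega>E by (simp add: measurable_restrict_space2_iff space_point_measure)
  define Y where "Y = (\<lambda>is. sum_list (map mu is)) ` words N"
  have finY: "finite Y" by (simp add: Y_def)
  have Y\<Omega>: "Y \<subseteq> \<Omega>"
  proof
    fix \<nu> assume "\<nu> \<in> Y"
    then obtain "is" where is_words: "is \<in> words N" "\<nu> = sum_list (map mu is)" by (auto simp: Y_def)
    have "?f \<nu> \<in> ?E" using mean_in_convex_hull[OF N is_words(1)] by (simp add: hull is_words(2))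
    then have "\<nu> \<in> (\<lambda>x. real N *\<^sub>R x) ` ?E"
      using N by (intro image_eqI[of _ _ "?f \<nu>"]) auto
    moreover have "sum_list (map mu js) \<in> weight_lattice G e" for js
    proof (induction js)
      case (Cons i js)
      then show ?case using lattice by (auto simp: weight_lattice_def blinfun.add_left)
    qed (simp add: weight_lattice_def)
    ultimately show "\<nu> \<in> \<Omega>" using N is_words(2) by (simp add: \<Omega>_def weyl_polytope_scale)
  qed
  have g_pos: "0 < g \<nu> \<longleftrightarrow> \<nu> \<in> Y" for \<nu>
    by (auto simp: g_def mult card_gt_0_iff words_with_sum_def Y_def zero_less_divide_iff)
  let ?S = "?f -` F \<inter> \<Omega>"
  have S_eq: "{\<nu> \<in> ?S. 0 < ennreal (g \<nu>)} = {\<nu> \<in> Y. ?f \<nu> \<in> F}"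
    using Y\<Omega> g_pos by (auto simp: ennreal_less_zero_iff)
  have "emeasure (weight_measure G T e \<rho> lam N) F = emeasure (point_measure \<Omega> (\<lambda>\<nu>. ennreal (g \<nu>))) ?S"
    unfolding weight_measure_def \<Omega>_def[symmetric] g_def[symmetric]
    using emeasure_distr[OF meas F] by (simp add: space_point_measure)
  also have "\<dots> = (\<Sum>\<nu> | \<nu> \<in> Y \<and> ?f \<nu> \<in> F. ennreal (g \<nu>))"
    using finY S_eq by (subst emeasure_point_measure) auto
  also have "\<dots> = ennreal (\<Sum>\<nu> | \<nu> \<in> Y \<and> ?f \<nu> \<in> F. g \<nu>)"
    by (intro sum_ennreal) (simp add: g_def)
  also have "(\<Sum>\<nu> | \<nu> \<in> Y \<and> ?f \<nu> \<in> F. g \<nu>)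
      = real (card {is\<in>words N. sum_list (map mu is) \<in> {\<nu> \<in> Y. ?f \<nu> \<in> F}}) / real CARD('n) ^ N"
    using finY by (subst card_words_sum_in) (simp_all add: g_def mult sum_divide_distrib)
  also have "{is\<in>words N. sum_list (map mu is) \<in> {\<nu> \<in> Y. ?f \<nu> \<in> F}} = {is\<in>words N. ?f (sum_list (map mu is)) \<in> F}"
    by (auto simp: Y_def)
  finally show ?thesis by (simp add: mean_prob_def)
qed

theorem theorem2:
  fixes G :: "'g monoid" and X :: "'g topology"
    and A :: "('g set \<times> ('g \<Rightarrow> 'e::euclidean_space)) set"
    and T :: "'g set" and e :: "'t::euclidean_space \<Rightarrow> 'g"
    and C :: "('t \<Rightarrow>\<^sub>L real) set" and lam :: "'t \<Rightarrow>\<^sub>L real"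
    and \<rho> :: "'g \<Rightarrow> complex^'n^'n"
  assumes "lie_group G X A" and "compact_space X" and "connected_space X" and "semisimple G A"
    and "maximal_torus G X T" and "torus_exponential G X T e"
    and "weyl_chamber G A T e C"
    and "lam \<in> dominant_weights G e C"
    and "irreducible_representation G X \<rho>" and "highest_weight G A T e C \<rho> lam"
  shows "large_deviation_principle (weyl_polytope G T e lam)
           (weight_measure G T e \<rho> lam) (rate_function G e \<rho>)"
proof -
  have G: "group G" and X: "topspace X = carrier G" using assms(1) by (auto simp: lie_group_def)
  have rep: "representation G X \<rho>" using assms(9) by (simp add: irreducible_representation_def)
  have C: "C \<noteq> {}" using assms(7) by (auto simp: weyl_chamber_def dest: in_components_nonempty)
  obtain P Q and mu :: "'n \<Rightarrow> 't \<Rightarrow>\<^sub>L real" where PQ: "P ** Q = mat 1" "Q ** P = mat 1"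
    and diag: "\<And>\<tau>. \<rho> (e \<tau>) ** P = P ** diag_mat (\<lambda>i. cis (2 * pi * blinfun_apply (mu i) \<tau>))"
    using representation_torus_diagonalizable[OF G assms(6) X assms(2) rep] by blast
  have lattice: "range mu \<subseteq> weight_lattice G e" and weights: "weights G e \<rho> = range mu"
    using weights_eq_range[where e = e and \<rho> = \<rho>, OF PQ diag rep] by auto
  have mult: "weight_mult e \<rho> N \<nu> = card (words_with_sum mu N \<nu>)" for N \<nu>
    by (rule weight_mult_eq_card[where e = e and \<rho> = \<rho>, OF PQ diag])
  have hull: "weyl_polytope G T e lam = convex hull (range mu)"
    by (rule weyl_polytope_eq_hull_weights[where e = e and \<rho> = \<rho>,
          OF assms(1) assms(2) assms(6) C rep assms(10) PQ diag])
  note emeas = weight_measure_eq_mean_prob[OF mult lattice hull, unfolded hull]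
  have space: "space (weight_measure G T e \<rho> lam N) = convex hull (range mu)" for N
    by (simp add: weight_measure_def hull space_restrict_space)
  have sets: "sets (weight_measure G T e \<rho> lam N) = sets (restrict_space borel (convex hull (range mu)))" for N
    by (simp add: weight_measure_def hull)
  have "large_deviation_principle (convex hull (range mu)) (weight_measure G T e \<rho> lam) (rate_function G e \<rho>)"
  proof (rule cramer_large_deviations)
    fix N :: nat assume N: "N \<ge> 1"
    show "prob_space (weight_measure G T e \<rho> lam N)"
    proof
      have "mean_prob mu N (convex hull (range mu)) = 1"
      proof -
        have "{is\<in>words N. (1 / real N) *\<^sub>R sum_list (map mu is) \<in> convex hull (range mu)} = words N"
          using mean_in_convex_hull[OF N] by auto
        then show ?thesis by (simp add: mean_prob_def card_words)
      qed
      moreover have "convex hull (range mu) \<in> sets (restrict_space borel (convex hull (range mu)))"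
        using sets.top[of "restrict_space borel (convex hull (range mu))"] by (simp add: space_restrict_space)
      ultimately show "emeasure (weight_measure G T e \<rho> lam N) (space (weight_measure G T e \<rho> lam N)) = 1"
        unfolding space using emeas[OF N] by simp
    qed
    fix F assume "F \<in> sets (restrict_space borel (convex hull (range mu)))"
    then show "measure (weight_measure G T e \<rho> lam N) F = mean_prob mu N F"
      using emeas[OF N] mean_prob_nonneg[of mu N F] by (simp add: measure_def)
  next
    fix x
    have "(\<Sum>\<nu>\<in>weights G e \<rho>. real (weight_mult e \<rho> 1 \<nu>) * exp (blinfun_apply \<nu> \<tau>))
        = (\<Sum>i\<in>UNIV. exp (blinfun_apply (mu i) \<tau>))" for \<tau>
    proof -
      have "(\<Sum>i\<in>UNIV. exp (blinfun_apply (mu i) \<tau>))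
          = (\<Sum>\<nu>\<in>range mu. \<Sum>i | i \<in> UNIV \<and> mu i = \<nu>. exp (blinfun_apply (mu i) \<tau>))"
        by (rule sum.image_gen) simp
      also have "\<dots> = (\<Sum>\<nu>\<in>range mu. real (card {i. mu i = \<nu>}) * exp (blinfun_apply \<nu> \<tau>))"
        by (intro sum.cong refl) simp
      finally show ?thesis by (simp only: weights mult card_words_with_sum_1)
    qed
    then show "rate_function G e \<rho> x = (SUP \<tau>. ereal (blinfun_apply x \<tau> - log_mgf mu \<tau>))"
      by (simp add: rate_function_def log_mgf_def)
  qed (simp_all add: space sets)
  then show ?thesis by (simp add: hull)
qed

end
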